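(* Let $\alpha,\gamma\in(0,1)$, $s\in[0,1)$, $c_0\in(0,1)$, and let $(L_i,W_i,\mathbf{x}_i)_{i=1}^m$ be the (label, winning score, side information) triples of $m$ hypotheses $H_1,\dots,H_m$, with $L_i\in\{\pm1\}$ and with $N\subseteq[m]$ the set of indices of the true null hypotheses. Assume that, conditioned on $W=(W_i)_{i=1}^m$, the side information $\mathbf{x}=(\mathbf{x}_i)_{i=1}^m$, and the labels $(L_i)_{i\notin N}$ of the false null hypotheses, the true null labels $(L_i)_{i\in N}$ are independent $\pm1$ random variables, each of which satisfies $\mathbb{P}(L_i=1)\le c_0$ (conditional probability). Then the RESET procedure in its FDX mode (defined in the context), run with threshold $\alpha$, confidence parameter $\gamma$, training probability $s$, bound $c_0$ and any rescoring model $f$, controls the FDX at threshold $\alpha$ with confidence $1-\gamma$: its discovery list $R_{\alpha,\gamma}$ satisfies $$\mathbb{P}\left(\frac{|R_{\alpha,\gamma}\cap N|}{|R_{\alpha,\gamma}|\vee 1}>\alpha\right)\le\gamma .$$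
   Context: Notation: $[m]=\{1,\dots,m\}$, $a\vee b=\max\{a,b\}$, and $F_{B(n,p)}$ denotes the CDF of a Binomial$(n,p)$ random variable. A hypothesis with $L_i=1$ is called a target win, one with $L_i=-1$ a decoy win. The set $N$ is non-random. The false discovery proportion (FDP) of a discovery list $R\subseteq[m]$ is $|R\cap N|/(|R|\vee1)$. RESET, FDX mode, with input $(L_i,W_i,\mathbf{x}_i)_{i=1}^m$, $\alpha$, $\gamma$, $s$, $c_0$, $f$: 1. Each index $i$ with $L_i=-1$ is independently (and independently of everything else) declared a training decoy with probability $s$. The pseudo labels are $\tilde L_i=-1$ if $i$ is a training decoy and $\tilde L_i=1$ otherwise. In particular $\tilde L_i=1$ whenever $L_i=1$. Let $J=\{i\in[m]:\tilde L_i=1\}$. 2. New real-valued scores are computed as $(\widetilde W_i)_{i=1}^m=f\big((W_i,\mathbf{x}_i,\tilde L_i)_{i=1}^m\big)$, where $f$ is an arbitrary (measurable) rescoring map. It may use auxiliary randomness independent of everything else, but it has no access to the labels $L_i$ other than through $\tilde L$. 3. The training decoys are discarded, and FDP-SD is applied to $(L_i,\widetilde W_i)_{i\in J}$ with parameters $\alpha,\gamma$ and $$c=c_e:=\frac{c_0}{1-s(1-c_0)}\in(0,1).$$ FDP-SD with parameters $c,\alpha,\gamma$ applied to $n$ label-score pairs: sort the pairs in decreasing order of score (ties broken at random). Let $A_i$ be the number of labels equal to $-1$ among the top $i$ scores. Put $\lambda=c$ and $R=(1-\lambda)/(c+1-\lambda)=1-c$, and $$i_0=\max\left\{1,\left\lceil\frac{\lceil\log_{1-R}(\gamma)\rceil-1}{\alpha}\right\rceil\right\}.$$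 For $i=i_0,\dots,n$ let $$\delta_i=\max\left\{d\in\{0,1,\dots,i\}:\ F_{B(\lfloor(i-d)\alpha\rfloor+1+d,\,R)}(d)\le\gamma\right\},$$ and set $$k_0=\lfloor(i-\delta_i)\alpha\rfloor+1,\qquad k_1=\lfloor(i-\delta_i-1)\alpha\rfloor+1,$$ $$p_0=F_{B(k_0+\delta_i,R)}(\delta_i),\qquad p_1=F_{B(k_1+\delta_i+1,R)}(\delta_i+1),\qquad w_i=\frac{p_1-\gamma}{p_1-p_0}.$$ Initialize $\delta_{i_0-1}=-1$ and $\bar\delta_{i_0-1}=0$. Randomized bounds $\bar\delta_i$ are then defined successively for $i=i_0,i_0+1,\dots,n$ as follows: - if $\bar\delta_{i-1}=\delta_i+1$, then $\bar\delta_i=\bar\delta_{i-1}$; - otherwise let $w'=w_i$ if $\delta_i>\delta_{i-1}$ and $w'=w_i/w_{i-1}$ if not, and set $\bar\delta_i=\delta_i$ with probability $w'$ and $\bar\delta_i=\delta_i+1$ with probability $1-w'$, using fresh randomness independent of everything else. Let $k_{FDP}$ be the largest $k\in\{i_0,\dots,n\}$ such that $A_i\le\bar\delta_i$ for all $i=i_0,\dots,k$, and $k_{FDP}=0$ if there is no such $k$. The discovery list consists of the indices $i$ that are ranked in the top $k_{FDP}$ and have $L_i=1$. *)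

theory Defs
  imports "HOL-Probability.Probability" "HOL-Combinatorics.Permutations"
begin

section \<open>Conditional independence given a sub-sigma-algebra\<close>

definition cond_prob_alg :: "'w measure \<Rightarrow> 'w measure \<Rightarrow> 'w set \<Rightarrow> 'w \<Rightarrow> real" where
  "cond_prob_alg M F A = real_cond_exp M F (indicator A)"

definition cond_indep_vars ::
  "'w measure \<Rightarrow> 'w measure \<Rightarrow> ('i \<Rightarrow> 'b measure) \<Rightarrow> ('i \<Rightarrow> 'w \<Rightarrow> 'b) \<Rightarrow> 'i set \<Rightarrow> bool" where
  "cond_indep_vars M F M' X I \<longleftrightarrow>
     (\<forall>i\<in>I. X i \<in> measurable M (M' i)) \<and>
     (\<forall>J\<subseteq>I. J \<noteq> {} \<longrightarrow> finite J \<longrightarrow>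
        (\<forall>A\<in>(\<Pi> j\<in>J. sets (M' j)).
           AE \<omega> in M. cond_prob_alg M F (\<Inter>j\<in>J. X j -` A j \<inter> space M) \<omega> =
             (\<Prod>j\<in>J. cond_prob_alg M F (X j -` A j \<inter> space M) \<omega>)))"


section \<open>FDP-SD\<close>

definition binom_cdf :: "nat \<Rightarrow> real \<Rightarrow> nat \<Rightarrow> real" where
  "binom_cdf n p d = measure_pmf.prob (binomial_pmf n p) {..d}"

definition sd_R :: "real \<Rightarrow> real" where
  "sd_R c = (let lam = c in (1 - lam) / (c + 1 - lam))"

definition sd_i0 :: "real \<Rightarrow> real \<Rightarrow> real \<Rightarrow> nat" where
  "sd_i0 c \<alpha> \<gamma> = max 1 (nat \<lceil>(real_of_int \<lceil>log (1 - sd_R c) \<gamma>\<rceil> - 1) / \<alpha>\<rceil>)"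

text \<open>
  \<open>sd_k \<alpha> i d\<close> is \<open>\<lfloor>(i - d) \<alpha>\<rfloor> + 1\<close>. The difference is taken in the reals and not truncated:
  for \<open>d = i + 1\<close>, which occurs as \<open>d = \<delta>\<^sub>i + 1\<close>, the value is 0.
\<close>

definition sd_k :: "real \<Rightarrow> nat \<Rightarrow> nat \<Rightarrow> nat" where
  "sd_k \<alpha> i d = nat (\<lfloor>(real i - real d) * \<alpha>\<rfloor> + 1)"

definition sd_p :: "real \<Rightarrow> real \<Rightarrow> nat \<Rightarrow> nat \<Rightarrow> real" where
  "sd_p c \<alpha> i d = binom_cdf (sd_k \<alpha> i d + d) (sd_R c) d"

definition sd_delta_nat :: "real \<Rightarrow> real \<Rightarrow> real \<Rightarrow> nat \<Rightarrow> nat" where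
  "sd_delta_nat c \<alpha> \<gamma> i = Max {d. d \<le> i \<and> sd_p c \<alpha> i d \<le> \<gamma>}"

text \<open>The value \<open>-1\<close> below \<open>i\<^sub>0\<close> is the initialization of \<open>\<delta>\<close> at \<open>i\<^sub>0 - 1\<close>.\<close>

definition sd_delta :: "real \<Rightarrow> real \<Rightarrow> real \<Rightarrow> nat \<Rightarrow> int" where
  "sd_delta c \<alpha> \<gamma> i = (if i < sd_i0 c \<alpha> \<gamma> then -1 else int (sd_delta_nat c \<alpha> \<gamma> i))"

definition sd_w :: "real \<Rightarrow> real \<Rightarrow> real \<Rightarrow> nat \<Rightarrow> real" where
  "sd_w c \<alpha> \<gamma> i =
     (let d = sd_delta_nat c \<alpha> \<gamma> i; p0 = sd_p c \<alpha> i d; p1 = sd_p c \<alpha> i (d + 1)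
      in (p1 - \<gamma>) / (p1 - p0))"

text \<open>
  The randomized bounds. The numbers \<open>u i\<close> are realizations of independent uniform variables on
  [0,1], so that \<open>u i \<le> w'\<close> is the fresh event of probability \<open>w'\<close>.
\<close>

primrec sd_bar :: "real \<Rightarrow> real \<Rightarrow> real \<Rightarrow> (nat \<Rightarrow> real) \<Rightarrow> nat \<Rightarrow> int" where
  "sd_bar c \<alpha> \<gamma> u 0 = 0"
| "sd_bar c \<alpha> \<gamma> u (Suc i) =
     (if Suc i < sd_i0 c \<alpha> \<gamma> then 0
      else if sd_bar c \<alpha> \<gamma> u i = sd_delta c \<alpha> \<gamma> (Suc i) + 1 then sd_bar c \<alpha> \<gamma> u i
      else
        (let w' = (if sd_delta c \<alpha> \<gamma> (Suc i) > sd_delta c \<alpha> \<gamma> i then sd_w c \<alpha> \<gamma> (Suc i)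
                   else sd_w c \<alpha> \<gamma> (Suc i) / sd_w c \<alpha> \<gamma> i)
         in if u (Suc i) \<le> w' then sd_delta c \<alpha> \<gamma> (Suc i) else sd_delta c \<alpha> \<gamma> (Suc i) + 1))"

text \<open>
  Position (starting at 1) of \<open>i\<close> in the list \<open>J\<close> sorted by decreasing score \<open>v\<close>, where tied
  scores are ordered by the values of the permutation \<open>p\<close>.
\<close>

definition score_rank :: "nat set \<Rightarrow> (nat \<Rightarrow> real) \<Rightarrow> (nat \<Rightarrow> nat) \<Rightarrow> nat \<Rightarrow> nat" where
  "score_rank J v p i = card {j \<in> J. v j > v i \<or> v j = v i \<and> p j \<le> p i}"

definition decoy_count ::
  "nat set \<Rightarrow> (nat \<Rightarrow> int) \<Rightarrow> (nat \<Rightarrow> real) \<Rightarrow> (nat \<Rightarrow> nat) \<Rightarrow> nat \<Rightarrow> nat" where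
  "decoy_count J l v p k = card {j \<in> J. score_rank J v p j \<le> k \<and> l j = -1}"

definition sd_kFDP ::
  "real \<Rightarrow> real \<Rightarrow> real \<Rightarrow> nat set \<Rightarrow> (nat \<Rightarrow> int) \<Rightarrow> (nat \<Rightarrow> real) \<Rightarrow> (nat \<Rightarrow> nat) \<Rightarrow> (nat \<Rightarrow> real) \<Rightarrow> nat" where
  "sd_kFDP c \<alpha> \<gamma> J l v p u =
     (let K = {k \<in> {sd_i0 c \<alpha> \<gamma>..card J}.
                 \<forall>i\<in>{sd_i0 c \<alpha> \<gamma>..k}. int (decoy_count J l v p i) \<le> sd_bar c \<alpha> \<gamma> u i}
      in if K = {} then 0 else Max K)"

definition fdp_sd ::
  "real \<Rightarrow> real \<Rightarrow> real \<Rightarrow> nat set \<Rightarrow> (nat \<Rightarrow> int) \<Rightarrow> (nat \<Rightarrow> real) \<Rightarrow> (nat \<Rightarrow> nat) \<Rightarrow> (nat \<Rightarrow> real) \<Rightarrow> nat set" where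
  "fdp_sd c \<alpha> \<gamma> J l v p u =
     {i \<in> J. score_rank J v p i \<le> sd_kFDP c \<alpha> \<gamma> J l v p u \<and> l i = 1}"


section \<open>RESET in FDX mode\<close>

definition pseudo_label :: "(nat \<Rightarrow> int) \<Rightarrow> (nat \<Rightarrow> bool) \<Rightarrow> nat \<Rightarrow> int" where
  "pseudo_label l t i = (if l i = -1 \<and> t i then -1 else 1)"

text \<open>
  The discovery list as a function of the data \<open>l\<close>, \<open>w\<close>, \<open>x\<close> and of the realized internal
  randomness: training coins \<open>t\<close> (only those at decoy wins matter), auxiliary randomness \<open>z\<close> of the
  rescoring map, tie-breaking permutation \<open>p\<close>, and uniform numbers \<open>u\<close> for the randomized bounds.
\<close>

definition reset_fdx ::
  "nat \<Rightarrow> real \<Rightarrow> real \<Rightarrow> real \<Rightarrow> real \<Rightarrow> ((nat \<Rightarrow> real \<times> 'x \<times> int) \<Rightarrow> 'z \<Rightarrow> nat \<Rightarrow> real) \<Rightarrow>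
   (nat \<Rightarrow> int) \<Rightarrow> (nat \<Rightarrow> real) \<Rightarrow> (nat \<Rightarrow> 'x) \<Rightarrow>
   (nat \<Rightarrow> bool) \<Rightarrow> 'z \<Rightarrow> (nat \<Rightarrow> nat) \<Rightarrow> (nat \<Rightarrow> real) \<Rightarrow> nat set" where
  "reset_fdx m \<alpha> \<gamma> s c0 f l w x t z p u =
     (let lt = pseudo_label l t;
          J = {i \<in> {1..m}. lt i = 1};
          wt = f (\<lambda>i\<in>{1..m}. (w i, x i, lt i)) z
      in fdp_sd (c0 / (1 - s * (1 - c0))) \<alpha> \<gamma> J l wt p u)"

definition FDP :: "nat set \<Rightarrow> nat set \<Rightarrow> real" where
  "FDP N R = real (card (R \<inter> N)) / real (max (card R) 1)"


section \<open>Probability spaces for the data and the internal randomness\<close>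

abbreviation label_space :: "int measure" where
  "label_space \<equiv> count_space {-1, 1}"

definition data_space :: "nat \<Rightarrow> 'x measure \<Rightarrow> ((nat \<Rightarrow> int) \<times> (nat \<Rightarrow> real \<times> 'x)) measure" where
  "data_space m MX = (\<Pi>\<^sub>M i\<in>{1..m}. label_space) \<Otimes>\<^sub>M (\<Pi>\<^sub>M i\<in>{1..m}. borel \<Otimes>\<^sub>M MX)"

definition data_vec ::
  "nat \<Rightarrow> (nat \<Rightarrow> 'w \<Rightarrow> int) \<Rightarrow> (nat \<Rightarrow> 'w \<Rightarrow> real) \<Rightarrow> (nat \<Rightarrow> 'w \<Rightarrow> 'x) \<Rightarrow>
   'w \<Rightarrow> (nat \<Rightarrow> int) \<times> (nat \<Rightarrow> real \<times> 'x)" where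
  "data_vec m L W x \<omega> = (\<lambda>i\<in>{1..m}. L i \<omega>, \<lambda>i\<in>{1..m}. (W i \<omega>, x i \<omega>))"

text \<open>The sigma-algebra generated by all scores, all side information, and the labels outside \<open>N\<close>.\<close>

definition nonnull_algebra ::
  "'w measure \<Rightarrow> nat \<Rightarrow> 'x measure \<Rightarrow> nat set \<Rightarrow>
   (nat \<Rightarrow> 'w \<Rightarrow> int) \<Rightarrow> (nat \<Rightarrow> 'w \<Rightarrow> real) \<Rightarrow> (nat \<Rightarrow> 'w \<Rightarrow> 'x) \<Rightarrow> 'w measure" where
  "nonnull_algebra M m MX N L W x =
     vimage_algebra (space M)
       (\<lambda>\<omega>. (\<lambda>i\<in>{1..m} - N. L i \<omega>, \<lambda>i\<in>{1..m}. (W i \<omega>, x i \<omega>)))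
       ((\<Pi>\<^sub>M i\<in>{1..m} - N. label_space) \<Otimes>\<^sub>M (\<Pi>\<^sub>M i\<in>{1..m}. borel \<Otimes>\<^sub>M MX))"

text \<open>
  Joint law of the internal randomness: independent training coins with success probability \<open>s\<close>,
  auxiliary randomness with law \<open>MZ\<close>, a uniformly distributed permutation, and independent uniform
  variables on [0,1]; all four components are independent.
\<close>

definition seed_law ::
  "nat \<Rightarrow> real \<Rightarrow> 'z measure \<Rightarrow> ((nat \<Rightarrow> bool) \<times> 'z \<times> (nat \<Rightarrow> nat) \<times> (nat \<Rightarrow> real)) measure" where
  "seed_law m s MZ =
     (\<Pi>\<^sub>M i\<in>{1..m}. measure_pmf (bernoulli_pmf s)) \<Otimes>\<^sub>M
     (MZ \<Otimes>\<^sub>M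
      (uniform_count_measure {p. p permutes {1..m}} \<Otimes>\<^sub>M
       (\<Pi>\<^sub>M i\<in>{1..m}. uniform_measure lborel {0..1})))"

definition seed_vec ::
  "nat \<Rightarrow> (nat \<Rightarrow> 'w \<Rightarrow> bool) \<Rightarrow> ('w \<Rightarrow> 'z) \<Rightarrow> ('w \<Rightarrow> nat \<Rightarrow> nat) \<Rightarrow> (nat \<Rightarrow> 'w \<Rightarrow> real) \<Rightarrow>
   'w \<Rightarrow> (nat \<Rightarrow> bool) \<times> 'z \<times> (nat \<Rightarrow> nat) \<times> (nat \<Rightarrow> real)" where
  "seed_vec m T Z P U \<omega> = (\<lambda>i\<in>{1..m}. T i \<omega>, Z \<omega>, P \<omega>, \<lambda>i\<in>{1..m}. U i \<omega>)"

end

theory Submission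
  imports Defs
begin

text \<open>
  Condition on the scores, the side information, the nonnull labels and the set \<open>J\<close> of pseudo
  targets. The null labels in \<open>J\<close> stay independent, each being a decoy with probability at least
  \<open>R = 1 - c\<close>, and the ranking of \<open>J\<close> is fixed. If the FDP exceeds \<open>\<alpha>\<close>, then, with
  \<open>\<delta>\<close> denoting the randomized bounds, the first index \<open>t\<close> at which the top \<open>t\<close> contain at least
  \<open>\<lfloor>(t - \<delta>\<^sub>t) \<alpha>\<rfloor> + 1 + \<delta>\<^sub>t\<close> nulls or nonnull decoys (or \<open>t = |J|\<close> if there is none) is at most
  \<open>k\<^sub>F\<^sub>D\<^sub>P\<close>, so that at most \<open>\<delta>\<^sub>t\<close> of these are decoys. Given \<open>\<delta>\<close> this has probability at most the value of the binomial
  CDF attached to \<open>(t, \<delta>\<^sub>t)\<close>. The index \<open>t\<close> is a stopping time of the chain \<open>\<delta>\<close>. At every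
  fixed index the expected CDF value is exactly \<open>\<gamma>\<close>, and since a stop at the larger of the two
  possible bounds implies a stop at the smaller one, the expected value at the stopping time is at
  most \<open>\<gamma>\<close>.
\<close>

section \<open>Binomial domination\<close>

text \<open>The index \<open>k_FDP\<close> depends on the null labels, so the decoys above it are
  not a binomial sample. The index \<open>t\<close> avoids this: it is read off from the ranking,
  \<open>N\<close>, the nonnull labels and the randomized bounds alone. For a fixed path of the
  bounds the candidates in the top \<open>t\<close> form a fixed set, whose decoys can be compared
  with independent trials. Nonnull decoys enter as trials that succeed surely, because the observed
  decoy counts contain them.

  The rest is an optional stopping argument. The CDF value is at most \<gamma> at the lower bound
  and above \<gamma> at the upper one, and the weight \<open>w_i\<close> balances the two. The
  quotient \<open>w_i / w_(i-1)\<close> keeps the lower bound at probability \<open>w_i\<close>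
  while \<delta> is constant. A rule that stops at the upper bound only could collect more than
  \<gamma>; it cannot occur because the number of trials does not fall when the bound grows.

  The constant \<open>c_e\<close> is the target probability, given membership in \<open>J\<close>,
  of a null whose target probability is exactly \<open>c0\<close>. Weights stay unnormalized
  throughout, so no conditioning on a set \<open>J\<close> of probability zero arises.\<close>

lemma binom_cdf_0: "p \<in> {0..1} \<Longrightarrow> binom_cdf 0 p d = 1"
  by (simp add: binom_cdf_def binomial_pmf_0)

lemma binom_cdf_nonneg: "0 \<le> binom_cdf n p d"
  by (simp add: binom_cdf_def)

lemma binom_cdf_mono: "d \<le> d' \<Longrightarrow> binom_cdf n p d \<le> binom_cdf n p d'"
  unfolding binom_cdf_def by (intro measure_pmf.finite_measure_mono) auto

text \<open>Conditioning on the first trial. The case distinction is needed because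
  \<open>d - 1\<close> is truncated: at \<open>d = 0\<close> a first success already exceeds the
  limit.\<close>

lemma binom_cdf_Suc:
  assumes "p \<in> {0..1}"
  shows "binom_cdf (Suc n) p d =
    p * (if d = 0 then 0 else binom_cdf n p (d - 1)) + (1 - p) * binom_cdf n p d"
proof -
  have *: "binomial_pmf (Suc n) p =
      bernoulli_pmf p \<bind> (\<lambda>b. map_pmf (\<lambda>k. (if b then 1 else 0) + k) (binomial_pmf n p))"
    by (simp add: binomial_pmf_Suc[OF assms] map_pmf_def)
  have plus: "(+) (Suc 0) = Suc" "(+) 0 = (\<lambda>k::nat. k)" by (auto simp: fun_eq_iff)
  have **: "(\<lambda>k. Suc k) -` {..d} = (if d = 0 then {} else {..d - 1})"
    by (auto split: if_splits)
  have "ennreal (binom_cdf (Suc n) p d) = emeasure (binomial_pmf (Suc n) p) {..d}"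
    by (simp add: binom_cdf_def measure_pmf.emeasure_eq_measure)
  also have "\<dots> = ennreal p * emeasure (binomial_pmf n p) ((\<lambda>k. Suc k) -` {..d})
      + ennreal (1 - p) * emeasure (binomial_pmf n p) {..d}"
    unfolding * emeasure_bind_pmf using assms by (simp add: mult.commute plus)
  also have "\<dots> = ennreal (p * measure_pmf.prob (binomial_pmf n p) ((\<lambda>k. Suc k) -` {..d})
      + (1 - p) * measure_pmf.prob (binomial_pmf n p) {..d})"
    using assms by (simp add: measure_pmf.emeasure_eq_measure ennreal_mult ennreal_plus)
  finally have "binom_cdf (Suc n) p d = p * measure_pmf.prob (binomial_pmf n p) ((\<lambda>k. Suc k) -` {..d})
      + (1 - p) * measure_pmf.prob (binomial_pmf n p) {..d}"
    using assms by (subst (asm) ennreal_inj) (auto simp: binom_cdf_nonneg)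
  then show ?thesis
    unfolding ** binom_cdf_def by simp
qed

lemma binom_cdf_full:
  assumes "p \<in> {0..1}" "n \<le> d"
  shows "binom_cdf n p d = 1"
  using assms(2)
proof (induction n arbitrary: d)
  case (Suc n)
  then show ?case by (simp add: binom_cdf_Suc[OF assms(1)])
qed (use assms in \<open>simp add: binom_cdf_0\<close>)

lemma binom_cdf_at_0: "p \<in> {0..1} \<Longrightarrow> binom_cdf n p 0 = (1 - p) ^ n"
  by (induction n) (simp_all add: binom_cdf_0 binom_cdf_Suc)

lemma binom_cdf_Suc_le:
  assumes "p \<in> {0..1}"
  shows "binom_cdf (Suc n) p d \<le> binom_cdf n p d"
proof -
  have "(if d = 0 then 0 else binom_cdf n p (d - 1)) \<le> binom_cdf n p d"
    by (auto simp: binom_cdf_nonneg intro!: binom_cdf_mono)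
  then have "p * (if d = 0 then 0 else binom_cdf n p (d - 1)) \<le> p * binom_cdf n p d"
    using assms by (intro mult_left_mono) auto
  then show ?thesis
    unfolding binom_cdf_Suc[OF assms] by (simp add: algebra_simps)
qed

lemma binom_cdf_le_Suc_Suc:
  assumes "p \<in> {0..1}"
  shows "binom_cdf n p d \<le> binom_cdf (Suc n) p (Suc d)"
proof -
  have "(1 - p) * binom_cdf n p d \<le> (1 - p) * binom_cdf n p (Suc d)"
    using assms by (intro mult_left_mono binom_cdf_mono) auto
  then show ?thesis
    unfolding binom_cdf_Suc[OF assms] by (simp add: algebra_simps)
qed

lemma binom_cdf_antimono:
  assumes "p \<in> {0..1}" "n \<le> n'"
  shows "binom_cdf n' p d \<le> binom_cdf n p d"
  using assms(2) by (induction rule: dec_induct) (auto intro: order_trans binom_cdf_Suc_le[OF assms(1)])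

text \<open>A further trial whose success is allowed can only help. This serves the end of the list,
  where there may be fewer candidates than trials.\<close>

lemma binom_cdf_add_le:
  assumes "p \<in> {0..1}"
  shows "binom_cdf n p d \<le> binom_cdf (n + k) p (d + k)"
  by (induction k) (auto intro: order_trans binom_cdf_le_Suc_Suc[OF assms])

lemma sum_PiE_insert:
  fixes f :: "('i \<Rightarrow> 'a) \<Rightarrow> 'b::comm_monoid_add"
  assumes "i \<notin> I"
  shows "(\<Sum>g\<in>PiE (insert i I) A. f g) = (\<Sum>y\<in>A i. \<Sum>g\<in>PiE I A. f (g(i := y)))"
proof -
  have "(\<Sum>g\<in>PiE (insert i I) A. f g) = (\<Sum>(y, g)\<in>A i \<times> PiE I A. f (g(i := y)))"
    unfolding PiE_insert_eq using inj_combinator[OF assms, of A]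
    by (subst sum.reindex) (auto simp: case_prod_unfold)
  then show ?thesis by (simp add: sum.cartesian_product)
qed

text \<open>The decoy count in \<open>B\<close> stochastically dominates a binomial variable with
  success probability \<open>1 - c\<close>, since each index of \<open>B\<close> gives the decoy
  label at least that share of its weight. The \<open>a i\<close> are unnormalized, so an index of
  mass zero needs no separate treatment. In the induction both \<open>B\<close> and \<open>e\<close>
  vary, as a decoy at the removed index uses up one unit of \<open>e\<close>.\<close>

lemma decoy_card_dominated:
  fixes a :: "'i \<Rightarrow> int \<Rightarrow> real"
  assumes "finite I" "B \<subseteq> I" "0 \<le> c" "c \<le> 1"
    and nonneg: "\<And>i y. i \<in> I \<Longrightarrow> 0 \<le> a i y"
    and target: "\<And>i. i \<in> B \<Longrightarrow> a i 1 \<le> c * (a i (-1) + a i 1)"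
  shows "(\<Sum>l\<in>I \<rightarrow>\<^sub>E {-1, 1}. (\<Prod>i\<in>I. a i (l i)) * of_bool (card {i \<in> B. l i = -1} \<le> e))
    \<le> binom_cdf (card B) (1 - c) e * (\<Prod>i\<in>I. a i (-1) + a i 1)"
  using assms(1,2,5,6)
proof (induction I arbitrary: B e rule: finite_induct)
  case empty
  then show ?case using assms by (simp add: binom_cdf_0)
next
  case (insert j I)
  have p: "1 - c \<in> {0..1}" using assms by simp
  define S where "S B e = (\<Sum>l\<in>I \<rightarrow>\<^sub>E {-1, 1}. (\<Prod>i\<in>I. a i (l i)) * of_bool (card {i \<in> B. l i = -1} \<le> e))" for B e
  define Q where "Q = (\<Prod>i\<in>I. a i (-1) + a i 1)"
  have Q: "0 \<le> Q" unfolding Q_def using insert.prems by (intro prod_nonneg) auto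
  define B' where "B' = B - {j}"
  have B': "B' \<subseteq> I" "finite B'" "j \<notin> B'"
    using insert by (auto simp: B'_def intro: finite_subset)
  have IH: "S B' e \<le> binom_cdf (card B') (1 - c) e * Q" for e
    unfolding S_def Q_def using insert.prems B' by (intro insert.IH) (auto simp: B'_def)
  have aj: "0 \<le> a j (-1)" "0 \<le> a j 1" using insert.prems by auto
  have prods: "(\<Prod>i\<in>I. a i ((l(j := y)) i)) = (\<Prod>i\<in>I. a i (l i))" for l y
    using insert by (intro prod.cong) auto
  have split: "(\<Sum>l\<in>insert j I \<rightarrow>\<^sub>E {-1, 1}. (\<Prod>i\<in>insert j I. a i (l i)) * of_bool (card {i \<in> B. l i = -1} \<le> e))
    = (\<Sum>y\<in>{-1,1}. a j y * (\<Sum>l\<in>I \<rightarrow>\<^sub>E {-1, 1}. (\<Prod>i\<in>I. a i (l i)) * of_bool (card {i \<in> B. (l(j := y)) i = -1} \<le> e)))"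
    unfolding sum_PiE_insert[OF \<open>j \<notin> I\<close>] using insert
    by (intro sum.cong refl) (simp add: sum_distrib_left prods fun_upd_same mult_ac del: fun_upd_apply)
  have tot: "(\<Prod>i\<in>insert j I. a i (-1) + a i 1) = (a j (-1) + a j 1) * Q"
    using insert by (simp add: Q_def)
  show ?case
  proof (cases "j \<in> B")
    case False
    then have "B' = B" by (auto simp: B'_def)
    have "{i \<in> B. (l(j := y)) i = -1} = {i \<in> B. l i = -1}" for l :: "'i \<Rightarrow> int" and y
      using False by auto
    then have "(\<Sum>l\<in>insert j I \<rightarrow>\<^sub>E {-1, 1}. (\<Prod>i\<in>insert j I. a i (l i)) * of_bool (card {i \<in> B. l i = -1} \<le> e))
      = (a j (-1) + a j 1) * S B e"
      unfolding split S_def by (simp add: algebra_simps)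
    also have "\<dots> \<le> (a j (-1) + a j 1) * (binom_cdf (card B) (1 - c) e * Q)"
      using IH[of e] aj \<open>B' = B\<close> by (intro mult_left_mono) auto
    finally show ?thesis unfolding tot by (simp add: mult_ac)
  next
    case True
    then have B: "B = insert j B'" by (auto simp: B'_def)
    have s1: "{i \<in> B. (l(j := 1)) i = -1} = {i \<in> B'. l i = -1}" for l :: "'i \<Rightarrow> int"
      using B' unfolding B by auto
    have s2: "{i \<in> B. (l(j := -1)) i = -1} = insert j {i \<in> B'. l i = -1}" for l :: "'i \<Rightarrow> int"
      using B' unfolding B by auto
    have c2: "card {i \<in> B. (l(j := -1)) i = -1} = Suc (card {i \<in> B'. l i = -1})" for l :: "'i \<Rightarrow> int"
      unfolding s2 using B' by (subst card_insert_disjoint) auto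
    have "(\<Sum>l\<in>insert j I \<rightarrow>\<^sub>E {-1, 1}. (\<Prod>i\<in>insert j I. a i (l i)) * of_bool (card {i \<in> B. l i = -1} \<le> e))
      = a j (-1) * (if e = 0 then 0 else S B' (e - 1)) + a j 1 * S B' e"
      unfolding split S_def by (cases e) (simp_all add: s1 c2 del: fun_upd_apply)
    also have "\<dots> \<le> a j (-1) * ((if e = 0 then 0 else binom_cdf (card B') (1 - c) (e - 1)) * Q)
        + a j 1 * (binom_cdf (card B') (1 - c) e * Q)"
      using IH[of e] IH[of "e - 1"] aj by (intro add_mono mult_left_mono) auto
    also have "\<dots> \<le> (a j (-1) + a j 1) * binom_cdf (Suc (card B')) (1 - c) e * Q"
    proof -
      define f0 where "f0 = (if e = 0 then 0 else binom_cdf (card B') (1 - c) (e - 1))"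
      define f1 where "f1 = binom_cdf (card B') (1 - c) e"
      have f: "f0 \<le> f1"
        by (auto simp: f0_def f1_def binom_cdf_nonneg intro!: binom_cdf_mono)
      \<comment> \<open>As \<open>f0 \<le> f1\<close>, moving mass from decoy to target raises the
        mixture. A target share of exactly \<open>c\<close> is the worst case, and for it the
        binomial recursion applies.\<close>
      have "a j 1 * (f1 - f0) \<le> c * (a j (-1) + a j 1) * (f1 - f0)"
        using insert.prems(3)[OF True] f by (intro mult_right_mono) auto
      then have "a j (-1) * f0 + a j 1 * f1 \<le> (a j (-1) + a j 1) * ((1 - c) * f0 + c * f1)"
        by (simp add: algebra_simps)
      then have "(a j (-1) * f0 + a j 1 * f1) * Q \<le> (a j (-1) + a j 1) * ((1 - c) * f0 + c * f1) * Q"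
        using Q by (rule mult_right_mono)
      then show ?thesis
        unfolding binom_cdf_Suc[OF p] f0_def[symmetric] f1_def[symmetric]
        by (simp add: algebra_simps)
    qed
    finally show ?thesis
      unfolding tot using B B' by (simp add: mult_ac)
  qed
qed

section \<open>The bounds of FDP-SD\<close>

lemma sd_R_eq: "sd_R c = 1 - c"
  by (simp add: sd_R_def)

lemma sd_k_mono: "0 \<le> \<alpha> \<Longrightarrow> i \<le> i' \<Longrightarrow> sd_k \<alpha> i d \<le> sd_k \<alpha> i' d"
  unfolding sd_k_def by (intro nat_mono add_right_mono floor_mono mult_right_mono) auto

lemma sd_k_antimono: "0 \<le> \<alpha> \<Longrightarrow> d \<le> d' \<Longrightarrow> sd_k \<alpha> i d' \<le> sd_k \<alpha> i d"
  unfolding sd_k_def by (intro nat_mono add_right_mono floor_mono mult_right_mono) auto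

text \<open>One target fewer lowers the product with \<alpha> by at most 1, hence also its floor.
  Consequently \<open>sd_k + d\<close> does not fall when \<open>d\<close> grows.\<close>

lemma sd_k_le_Suc: 
  assumes "\<alpha> \<le> 1"
  shows "sd_k \<alpha> i d \<le> sd_k \<alpha> i (Suc d) + 1"
proof -
  have "\<lfloor>(real i - real d) * \<alpha>\<rfloor> - 1 = \<lfloor>(real i - real d) * \<alpha> - 1\<rfloor>" by simp
  also have "\<dots> \<le> \<lfloor>(real i - real (Suc d)) * \<alpha>\<rfloor>"
    using assms by (intro floor_mono) (simp add: algebra_simps)
  finally show ?thesis unfolding sd_k_def by linarith
qed

locale fdp_sd_params =
  fixes c \<alpha> \<gamma> :: real
  assumes c: "0 < c" "c < 1" and alpha: "0 < \<alpha>" "\<alpha> < 1" and gamma: "0 < \<gamma>" "\<gamma> < 1"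
begin

abbreviation "pv \<equiv> sd_p c \<alpha>"
abbreviation "i0 \<equiv> sd_i0 c \<alpha> \<gamma>"
abbreviation "dn \<equiv> sd_delta_nat c \<alpha> \<gamma>"
abbreviation "dl \<equiv> sd_delta c \<alpha> \<gamma>"
abbreviation "wt \<equiv> sd_w c \<alpha> \<gamma>"
abbreviation "bar \<equiv> sd_bar c \<alpha> \<gamma>"

lemma R_range: "sd_R c \<in> {0..1}"
  using c by (simp add: sd_R_eq)

lemma sd_p_nonneg: "0 \<le> pv i d"
  by (simp add: sd_p_def binom_cdf_nonneg)

lemma sd_p_antimono: "i \<le> i' \<Longrightarrow> pv i' d \<le> pv i d"
  unfolding sd_p_def using sd_k_mono[of \<alpha> i i' d] alpha
  by (intro binom_cdf_antimono[OF R_range]) auto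

text \<open>Here there are as many allowed successes as trials. A value above \<gamma> at this place
  makes \<open>dn i + 1\<close> a proper upper bound even when \<open>dn i = i\<close>.\<close>

lemma sd_p_Suc_self: "pv i (Suc i) = 1"
proof -
  have "sd_k \<alpha> i (Suc i) = 0"
    using alpha by (simp add: sd_k_def) linarith
  then show ?thesis by (simp add: sd_p_def binom_cdf_full[OF R_range])
qed

lemma i0_pos: "1 \<le> i0"
  by (simp add: sd_i0_def)

text \<open>The origin of \<open>i0\<close>: with no success allowed the CDF is
  \<open>c ^ sd_k\<close>, which is at most \<gamma> once \<open>sd_k\<close> reaches
  \<open>log c \<gamma>\<close>, rounded up. From \<open>i0\<close> on the set defining
  \<open>dn\<close> therefore contains 0.\<close>

lemma sd_p_0_le:
  assumes "i0 \<le> i"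
  shows "pv i 0 \<le> \<gamma>"
proof -
  define X where "X = \<lceil>log c \<gamma>\<rceil>"
  have "(real_of_int X - 1) / \<alpha> \<le> real i0"
    unfolding sd_i0_def X_def by (simp add: sd_R_eq) linarith
  also have "real i0 \<le> real i" using assms by simp
  finally have "real_of_int X - 1 \<le> real i * \<alpha>"
    using alpha by (simp add: pos_divide_le_eq)
  then have "X - 1 \<le> \<lfloor>real i * \<alpha>\<rfloor>" by (simp add: le_floor_iff)
  then have "X \<le> int (sd_k \<alpha> i 0)" by (simp add: sd_k_def)
  then have "log c \<gamma> \<le> real (sd_k \<alpha> i 0)"
    unfolding X_def by (simp add: ceiling_le_iff)
  then have "c powr real (sd_k \<alpha> i 0) \<le> c powr log c \<gamma>"
    using c by (simp add: powr_mono')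
  also have "c powr log c \<gamma> = \<gamma>" using c gamma by simp
  finally show ?thesis
    using c by (simp add: sd_p_def binom_cdf_at_0[OF R_range] powr_realpow, simp add: sd_R_eq)
qed

lemma sd_delta_nat:
  assumes "i0 \<le> i"
  shows "dn i \<le> i" "pv i (dn i) \<le> \<gamma>" "\<gamma> < pv i (Suc (dn i))"
proof -
  let ?S = "{d. d \<le> i \<and> pv i d \<le> \<gamma>}"
  have fin: "finite ?S" by simp
  have "0 \<in> ?S" using sd_p_0_le[OF assms] by simp
  then have "dn i \<in> ?S"
    unfolding sd_delta_nat_def by (intro Max_in fin) auto
  then show "dn i \<le> i" "pv i (dn i) \<le> \<gamma>" by auto
  show "\<gamma> < pv i (Suc (dn i))"
  proof (cases "dn i = i")
    case True
    then show ?thesis using gamma by (simp add: sd_p_Suc_self)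
  next
    case False
    then have "Suc (dn i) \<le> i" using \<open>dn i \<le> i\<close> by simp
    moreover have "Suc (dn i) \<notin> ?S"
    proof
      assume "Suc (dn i) \<in> ?S"
      from Max_ge[OF fin this] show False unfolding sd_delta_nat_def by simp
    qed
    ultimately show ?thesis by simp
  qed
qed

lemma sd_delta_nat_mono:
  assumes "i0 \<le> i" "i \<le> i'"
  shows "dn i \<le> dn i'"
proof -
  have "pv i' (dn i) \<le> \<gamma>"
    using sd_p_antimono[OF assms(2), of "dn i"] sd_delta_nat(2)[OF assms(1)] by linarith
  then have "dn i \<in> {d. d \<le> i' \<and> pv i' d \<le> \<gamma>}"
    using sd_delta_nat(1)[OF assms(1)] assms by simp
  then show ?thesis
    unfolding sd_delta_nat_def[of c \<alpha> \<gamma> i'] by (intro Max_ge) auto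
qed

text \<open>The weight is the solution of the third equation: if the lower bound is taken with
  probability \<open>wt i\<close>, the mean CDF value is \<gamma>. Positivity permits the division
  in \<open>step_w\<close>.\<close>

lemma sd_w:
  assumes "i0 \<le> i"
  shows "0 < wt i" "wt i \<le> 1" "wt i * pv i (dn i) + (1 - wt i) * pv i (Suc (dn i)) = \<gamma>"
proof -
  note d = sd_delta_nat[OF assms]
  have w: "wt i = (pv i (Suc (dn i)) - \<gamma>) / (pv i (Suc (dn i)) - pv i (dn i))"
    by (simp add: sd_w_def Let_def)
  have pos: "0 < pv i (Suc (dn i)) - pv i (dn i)" using d by linarith
  show "0 < wt i" "wt i \<le> 1" using d pos unfolding w by (auto simp: field_simps)
  have "wt i * (pv i (Suc (dn i)) - pv i (dn i)) = pv i (Suc (dn i)) - \<gamma>"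
    using pos unfolding w by simp
  then show "wt i * pv i (dn i) + (1 - wt i) * pv i (Suc (dn i)) = \<gamma>"
    by (simp add: algebra_simps)
qed

text \<open>CDF values decrease in \<open>i\<close>, so the old weight would give at most \<gamma>
  at \<open>Suc i\<close>; restoring \<gamma> needs more weight on the upper bound. Thus the
  quotient in \<open>step_w\<close> is a probability.\<close>

lemma sd_w_antimono:
  assumes i: "i0 \<le> i" and eq: "dn (Suc i) = dn i"
  shows "wt (Suc i) \<le> wt i"
proof -
  have i': "i0 \<le> Suc i" using i by simp
  define p0 p1 q0 q1 where "p0 = pv i (dn i)" "p1 = pv i (Suc (dn i))"
    "q0 = pv (Suc i) (dn i)" "q1 = pv (Suc i) (Suc (dn i))"
  have le: "q0 \<le> p0" "q1 \<le> p1" 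
    unfolding p0_p1_q0_q1_def by (simp_all add: sd_p_antimono)
  have "wt i * q0 + (1 - wt i) * q1 \<le> wt i * p0 + (1 - wt i) * p1"
    using sd_w[OF i] le by (intro add_mono mult_left_mono) auto
  also have "\<dots> = wt (Suc i) * q0 + (1 - wt (Suc i)) * q1"
    using sd_w(3)[OF i] sd_w(3)[OF i'] eq by (simp add: p0_p1_q0_q1_def)
  finally have "(wt (Suc i) - wt i) * (q1 - q0) \<le> 0" by (simp add: algebra_simps)
  moreover have "0 < q1 - q0"
    using sd_delta_nat[OF i'] eq by (simp add: p0_p1_q0_q1_def)
  ultimately show ?thesis by (simp add: mult_le_0_iff)
qed

text \<open>The probability \<open>w'\<close> of the procedure for the passage from \<open>i\<close>
  to \<open>Suc i\<close>. At \<open>i = i0 - 1\<close> the first branch applies, as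
  \<open>dl\<close> is \<open>-1\<close> there.\<close>

definition step_w :: "nat \<Rightarrow> real" where
  "step_w i = (if dl i < dl (Suc i) then wt (Suc i) else wt (Suc i) / wt i)"

lemma sd_delta_eq: "i0 \<le> i \<Longrightarrow> dl i = int (dn i)"
  by (simp add: sd_delta_def)

lemma sd_bar_Suc:
  assumes "i0 \<le> Suc i"
  shows "bar u (Suc i) =
    (if bar u i = dl (Suc i) + 1 then bar u i
     else if u (Suc i) \<le> step_w i then dl (Suc i) else dl (Suc i) + 1)"
  using assms by (simp add: step_w_def Let_def)

lemma step_w_range:
  assumes "i0 \<le> Suc i"
  shows "0 \<le> step_w i" "step_w i \<le> 1"
proof -
  have "0 \<le> step_w i \<and> step_w i \<le> 1"
  proof (cases "dl i < dl (Suc i)")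
    case True
    then show ?thesis using sd_w[OF assms] by (simp add: step_w_def)
  next
    case False
    then have i: "i0 \<le> i" using assms by (auto simp: sd_delta_def split: if_splits)
    then have eq: "dn (Suc i) = dn i"
      using False sd_delta_nat_mono[OF i, of "Suc i"] by (simp add: sd_delta_eq)
    show ?thesis
      using False sd_w[OF i] sd_w[OF assms] sd_w_antimono[OF i eq] by (simp add: step_w_def)
  qed
  then show "0 \<le> step_w i" "step_w i \<le> 1" by auto
qed

lemma sd_bar_cases:
  assumes "i0 \<le> i"
  shows "bar u i = int (dn i) \<or> bar u i = int (Suc (dn i))"
proof (cases i)
  case 0
  then show ?thesis using assms i0_pos by simp
next
  case (Suc j)
  then show ?thesis using assms by (simp add: sd_bar_Suc sd_delta_eq)
qed

text \<open>If \<open>dn\<close> rises, the new lower bound already reaches the old upper one;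
  otherwise the only possible move is from the lower to the upper bound.\<close>

lemma sd_bar_mono:
  assumes "i0 \<le> i"
  shows "bar u i \<le> bar u (Suc i)"
  using sd_bar_cases[OF assms, of u] sd_delta_nat_mono[OF assms, of "Suc i"] assms
  by (auto simp: sd_bar_Suc sd_delta_eq)

lemma sd_bar_cong:
  "(\<And>j. i0 \<le> j \<Longrightarrow> j \<le> i \<Longrightarrow> u j = u' j) \<Longrightarrow> bar u i = bar u' i"
  by (induction i) (simp_all add: Let_def)

text \<open>
  \<open>expected_payoff\<close> is the conditional expectation of the payoff \<open>sd_p\<close> at the stopping time determined by \<open>st\<close>
  (forced to stop after \<open>k\<close> steps), given the present state \<open>x\<close> of the randomized bound.
\<close>

primrec expected_payoff :: "(nat \<Rightarrow> int \<Rightarrow> bool) \<Rightarrow> nat \<Rightarrow> nat \<Rightarrow> int \<Rightarrow> real" where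
  "expected_payoff st 0 i x = pv i (nat x)"
| "expected_payoff st (Suc k) i x =
    (if st i x then pv i (nat x)
     else if x = dl (Suc i) + 1 then expected_payoff st k (Suc i) x
     else step_w i * expected_payoff st k (Suc i) (dl (Suc i)) +
       (1 - step_w i) * expected_payoff st k (Suc i) (dl (Suc i) + 1))"

text \<open>The pathwise counterpart of \<open>expected_payoff\<close>: the bound follows one
  realization \<open>u\<close> instead of being averaged.\<close>

primrec payoff :: "(nat \<Rightarrow> int \<Rightarrow> bool) \<Rightarrow> nat \<Rightarrow> nat \<Rightarrow> (nat \<Rightarrow> real) \<Rightarrow> real" where
  "payoff st 0 i u = pv i (nat (bar u i))"
| "payoff st (Suc k) i u = (if st i (bar u i) then pv i (nat (bar u i)) else payoff st k (Suc i) u)"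

lemma expected_payoff_nonneg: "i0 \<le> Suc i \<Longrightarrow> 0 \<le> expected_payoff st k i x"
  by (induction k arbitrary: i x) (auto simp: sd_p_nonneg step_w_range)

lemma payoff_nonneg: "0 \<le> payoff st k i u"
  by (induction k arbitrary: i) (auto simp: sd_p_nonneg)

text \<open>Backward induction with two invariants. The first averages over the law of the bound at
  \<open>i\<close>, which gives the lower state probability \<open>wt i\<close>. The second says
  that continuing from the upper state never beats stopping there; it covers the case in which only
  the lower state stops.\<close>

lemma expected_payoff_bounds:
  assumes st: "\<And>i d. st i (int (Suc d)) \<Longrightarrow> st i (int d)"
    and i: "i0 \<le> i"
  shows "wt i * expected_payoff st k i (dl i) + (1 - wt i) * expected_payoff st k i (dl i + 1) \<le> \<gamma>
    \<and> expected_payoff st k i (dl i + 1) \<le> pv i (Suc (dn i))"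
  using i
proof (induction k arbitrary: i)
  case 0
  then show ?case
    using sd_w(3)[OF 0] by (simp add: sd_delta_eq nat_add_distrib)
next
  case (Suc k)
  define j where "j = Suc i"
  have j: "i0 \<le> j" using Suc.prems by (simp add: j_def)
  note IH = Suc.IH[OF j]
  note w = sd_w[OF Suc.prems] and d = sd_delta_nat[OF Suc.prems]
  define lo hi where "lo = expected_payoff st k j (dl j)" "hi = expected_payoff st k j (dl j + 1)"
  have IH: "wt j * lo + (1 - wt j) * hi \<le> \<gamma>" "hi \<le> pv j (Suc (dn j))"
    using IH by (auto simp: lo_hi_def)
  have nat1: "nat (dl i + 1) = Suc (dn i)"
    using Suc.prems by (simp add: sd_delta_eq nat_add_distrib)
  have mono: "dn i \<le> dn j" using sd_delta_nat_mono[OF Suc.prems, of j] by (simp add: j_def)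
  \<comment> \<open>When \<open>dn\<close> rises, both states at \<open>i\<close> lie below
    \<open>dl j + 1\<close>, so the bound is drawn afresh and the state at \<open>i\<close> is
    forgotten.\<close>
  have fresh: "expected_payoff st (Suc k) i x = wt j * lo + (1 - wt j) * hi"
    if "\<not> st i x" "dn i < dn j" "x = dl i \<or> x = dl i + 1" for x
    using that Suc.prems j by (auto simp: step_w_def sd_delta_eq lo_hi_def j_def[symmetric])
  have B: "expected_payoff st (Suc k) i (dl i + 1) \<le> pv i (Suc (dn i))"
  proof (cases "st i (dl i + 1)")
    case True
    then show ?thesis by (simp add: nat1)
  next
    case False
    show ?thesis
    proof (cases "dn i < dn j")
      case True
      \<comment> \<open>Continuing is worth at most \<gamma>, which is below
        \<open>pv i (Suc (dn i))\<close>.\<close>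
      then show ?thesis using fresh[OF False True] IH d by simp
    next
      case nl: False
      then have eq: "dn j = dn i" using mono by simp
      then have "expected_payoff st (Suc k) i (dl i + 1) = hi"
        using False Suc.prems j by (simp add: sd_delta_eq lo_hi_def j_def[symmetric])
      also have "\<dots> \<le> pv j (Suc (dn i))" using IH eq by simp
      also have "\<dots> \<le> pv i (Suc (dn i))" by (rule sd_p_antimono) (simp add: j_def)
      finally show ?thesis .
    qed
  qed
  have A: "wt i * expected_payoff st (Suc k) i (dl i) + (1 - wt i) * expected_payoff st (Suc k) i (dl i + 1) \<le> \<gamma>"
  proof (cases "st i (dl i)")
    case True
    then have "expected_payoff st (Suc k) i (dl i) = pv i (dn i)"
      using Suc.prems by (simp add: sd_delta_eq)
    \<comment> \<open>By \<open>B\<close>, the upper state is worth no more than stopping there too,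
      and stopping in both states is worth exactly \<gamma>.\<close>
    then have "wt i * expected_payoff st (Suc k) i (dl i) + (1 - wt i) * expected_payoff st (Suc k) i (dl i + 1)
      \<le> wt i * pv i (dn i) + (1 - wt i) * pv i (Suc (dn i))"
      using B w by (intro add_mono mult_left_mono) auto
    then show ?thesis using w by simp
  next
    case False
    \<comment> \<open>Monotonicity of \<open>st\<close> rules out a stop in the upper state
      alone.\<close>
    then have F1: "\<not> st i (dl i + 1)"
      using st[of i "dn i"] Suc.prems by (auto simp: sd_delta_eq add.commute)
    show ?thesis
    proof (cases "dn i < dn j")
      case True
      have lo: "expected_payoff st (Suc k) i (dl i) = wt j * lo + (1 - wt j) * hi"
        by (rule fresh[OF False True]) simp
      have hi: "expected_payoff st (Suc k) i (dl i + 1) = wt j * lo + (1 - wt j) * hi"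
        by (rule fresh[OF F1 True]) simp
      show ?thesis unfolding lo hi using IH by (simp add: algebra_simps)
    next
      case nl: False
      then have eq: "dn j = dn i" using mono by simp
      \<comment> \<open>The lower state at \<open>j\<close> is reached only from the lower state at
        \<open>i\<close>; the quotient in \<open>step_w\<close> gives it probability
        \<open>wt j\<close>.\<close>
      have s: "wt i * step_w i = wt j"
        using w eq Suc.prems j by (simp add: step_w_def sd_delta_eq j_def[symmetric])
      have lo: "expected_payoff st (Suc k) i (dl i) = step_w i * lo + (1 - step_w i) * hi"
        using False Suc.prems j eq by (simp add: sd_delta_eq lo_hi_def j_def[symmetric])
      have hi: "expected_payoff st (Suc k) i (dl i + 1) = hi"
        using F1 Suc.prems j eq by (simp add: sd_delta_eq lo_hi_def j_def[symmetric])
      have "wt i * expected_payoff st (Suc k) i (dl i) + (1 - wt i) * expected_payoff st (Suc k) i (dl i + 1)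
        = (wt i * step_w i) * lo + (1 - wt i * step_w i) * hi"
        unfolding lo hi by (simp add: algebra_simps)
      then show ?thesis using IH unfolding s by simp
    qed
  qed
  show ?case using A B by simp
qed

end

section \<open>Expectation over the randomized bounds\<close>

abbreviation unif :: "real measure" where
  "unif \<equiv> uniform_measure lborel {0..1}"

lemma prob_space_unif: "prob_space unif"
  by (rule prob_space_uniform_measure) auto

lemma ennreal_divide_one: "a / 1 = (a::ennreal)"
  by (simp add: divide_ennreal_def)

lemma emeasure_unif_atMost:
  assumes "0 \<le> w" "w \<le> 1"
  shows "emeasure unif {..w} = ennreal w"
proof -
  have "{0..1} \<inter> {..w} = {0..w}" using assms by auto
  then show ?thesis using assms by (simp add: ennreal_divide_one)
qed

lemma emeasure_unif_greaterThan:
  assumes "0 \<le> w" "w \<le> 1"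
  shows "emeasure unif {w<..} = ennreal (1 - w)"
proof -
  have "{0..1} \<inter> {w<..} = {w<..1}" using assms by auto
  then show ?thesis using assms by (simp add: ennreal_divide_one)
qed

lemma nn_integral_unif_threshold:
  assumes "0 \<le> w" "w \<le> 1"
  shows "(\<integral>\<^sup>+y. (if y \<le> w then A else B) \<partial>unif) = ennreal w * A + ennreal (1 - w) * B"
proof -
  have "(\<integral>\<^sup>+y. (if y \<le> w then A else B) \<partial>unif) =
      (\<integral>\<^sup>+y. A * indicator {..w} y + B * indicator {w<..} y \<partial>unif)"
    by (intro nn_integral_cong) (auto simp: indicator_def)
  also have "\<dots> = A * emeasure unif {..w} + B * emeasure unif {w<..}"
    by (subst nn_integral_add) (auto simp: nn_integral_cmult_indicator)
  finally show ?thesis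
    using assms by (simp add: emeasure_unif_atMost emeasure_unif_greaterThan mult.commute del: emeasure_uniform_measure)
qed

lemma measurable_sd_bar:
  assumes "\<And>j. 1 \<le> j \<Longrightarrow> j \<le> i \<Longrightarrow> (\<lambda>\<omega>. a \<omega> j) \<in> borel_measurable \<Omega>"
  shows "(\<lambda>\<omega>. sd_bar c \<alpha> \<gamma> (a \<omega>) i) \<in> measurable \<Omega> (count_space UNIV)"
  using assms
proof (induction i)
  case (Suc i)
  have IH: "(\<lambda>\<omega>. sd_bar c \<alpha> \<gamma> (a \<omega>) i) \<in> measurable \<Omega> (count_space UNIV)"
    using Suc by auto
  have [measurable]: "(\<lambda>\<omega>. a \<omega> (Suc i)) \<in> borel_measurable \<Omega>"
    using Suc by auto
  show ?case
    unfolding sd_bar.simps Let_def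
    by (rule measurable_compose_countable[OF _ IH]) measurable
qed simp

context fdp_sd_params begin

lemma measurable_payoff:
  assumes "\<And>j. 1 \<le> j \<Longrightarrow> j \<le> i + k \<Longrightarrow> (\<lambda>\<omega>. a \<omega> j) \<in> borel_measurable \<Omega>"
  shows "(\<lambda>\<omega>. payoff st k i (a \<omega>)) \<in> borel_measurable \<Omega>"
  using assms
proof (induction k arbitrary: i)
  case 0
  have "(\<lambda>\<omega>. bar (a \<omega>) i) \<in> measurable \<Omega> (count_space UNIV)"
    using 0 by (intro measurable_sd_bar) auto
  from measurable_compose[OF this, of "\<lambda>x. pv i (nat x)" borel] show ?case by simp
next
  case (Suc k)
  have [measurable]: "(\<lambda>\<omega>. bar (a \<omega>) i) \<in> measurable \<Omega> (count_space UNIV)"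
    using Suc by (intro measurable_sd_bar) auto
  have [measurable]: "(\<lambda>\<omega>. payoff st k (Suc i) (a \<omega>)) \<in> borel_measurable \<Omega>"
    using Suc.prems by (intro Suc.IH) auto
  have [measurable]: "(\<lambda>\<omega>. pv i (nat (bar (a \<omega>) i))) \<in> borel_measurable \<Omega>"
    by (rule measurable_compose[of _ _ "count_space UNIV"]) auto
  have [measurable]: "Measurable.pred \<Omega> (\<lambda>\<omega>. st i (bar (a \<omega>) i))"
    by (rule measurable_compose[of _ _ "count_space UNIV" "st i"]) auto
  show ?case by simp
qed

lemma payoff_cong:
  "(\<And>j. i0 \<le> j \<Longrightarrow> j \<le> i + k \<Longrightarrow> u j = u' j) \<Longrightarrow> payoff st k i u = payoff st k i u'"
proof (induction k arbitrary: i)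
  case 0
  then show ?case using sd_bar_cong[of i u u'] by simp
next
  case (Suc k)
  then show ?case using sd_bar_cong[of i u u'] by simp
qed

text \<open>The history up to \<open>i\<close> is frozen in \<open>u\<close>. Each induction step
  splits off coordinate \<open>Suc i\<close> and moves its value into the history as
  \<open>u(Suc i := z)\<close>, which is why \<open>u\<close> varies.\<close>

lemma nn_integral_payoff:
  assumes "i0 \<le> Suc i"
  shows "(\<integral>\<^sup>+y. ennreal (payoff st k i (\<lambda>j. if j \<le> i then u j else y j)) \<partial>PiM {Suc i..i + k} (\<lambda>_. unif))
    = ennreal (expected_payoff st k i (bar u i))"
  using assms
proof (induction k arbitrary: i u)
  case 0
  have "bar (\<lambda>j. if j \<le> i then u j else y j) i = bar u i" for y
    by (rule sd_bar_cong) simp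
  then show ?case
    by (simp add: prob_space.emeasure_space_1 prob_space_PiM prob_space_unif)
next
  case (Suc k)
  interpret product_sigma_finite "\<lambda>_::nat. unif"
    by unfold_locales (rule prob_space_imp_sigma_finite[OF prob_space_unif, THEN sigma_finite_measure.sigma_finite_countable])
  interpret U: prob_space unif by (rule prob_space_unif)
  interpret P: prob_space "PiM I (\<lambda>_::nat. unif)" for I :: "nat set"
    by (intro prob_space_PiM prob_space_unif)
  define I where "I = {Suc (Suc i)..Suc i + k}"
  have I: "{Suc i..i + Suc k} = insert (Suc i) I" "Suc i \<notin> I" "finite I"
    by (auto simp: I_def)
  have i': "i0 \<le> Suc (Suc i)" using Suc.prems by simp
  define mg where "mg y = (\<lambda>j. if j \<le> i then u j else y j)" for y :: "nat \<Rightarrow> real"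
  have bar_mg: "bar (mg y) i = bar u i" for y
    unfolding mg_def by (rule sd_bar_cong) simp
  show ?case
  proof (cases "st i (bar u i)")
    case True
    then have "payoff st (Suc k) i (mg y) = pv i (nat (bar u i))" for y
      by (simp add: bar_mg)
    then show ?thesis using True unfolding mg_def[symmetric] by (simp add: P.emeasure_space_1)
  next
    case False
    have m: "(\<lambda>y. ennreal (payoff st k (Suc i) (mg y))) \<in> borel_measurable (PiM (insert (Suc i) I) (\<lambda>_. unif))"
    proof (intro measurable_compose[OF measurable_payoff measurable_ennreal])
      fix j assume "1 \<le> j" "j \<le> Suc i + k"
      then have "j \<le> i \<or> j \<in> insert (Suc i) I" by (auto simp: I_def)
      then show "(\<lambda>y. mg y j) \<in> borel_measurable (PiM (insert (Suc i) I) (\<lambda>_. unif))"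
      proof
        assume "j \<in> insert (Suc i) I"
        then have "(\<lambda>y. y j) \<in> measurable (PiM (insert (Suc i) I) (\<lambda>_. unif)) unif"
          by (rule measurable_component_singleton)
        then show ?thesis by (cases "j \<le> i") (simp_all add: mg_def cong: measurable_cong_sets)
      qed (simp add: mg_def)
    qed
    have "(\<integral>\<^sup>+y. ennreal (payoff st (Suc k) i (mg y)) \<partial>PiM (insert (Suc i) I) (\<lambda>_. unif))
      = (\<integral>\<^sup>+y. ennreal (payoff st k (Suc i) (mg y)) \<partial>PiM (insert (Suc i) I) (\<lambda>_. unif))"
      using False by (simp add: bar_mg)
    also have "\<dots> = (\<integral>\<^sup>+z. (\<integral>\<^sup>+y. ennreal (payoff st k (Suc i) (mg (y(Suc i := z)))) \<partial>PiM I (\<lambda>_. unif)) \<partial>unif)"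
      by (rule product_nn_integral_insert_rev[OF I(3,2) m])
    also have "\<dots> = (\<integral>\<^sup>+z. ennreal (expected_payoff st k (Suc i) (bar (u(Suc i := z)) (Suc i))) \<partial>unif)"
    proof (rule nn_integral_cong)
      fix z
      have "mg (y(Suc i := z)) = (\<lambda>j. if j \<le> Suc i then (u(Suc i := z)) j else y j)" for y
        by (auto simp: mg_def fun_eq_iff le_Suc_eq)
      then show "(\<integral>\<^sup>+y. ennreal (payoff st k (Suc i) (mg (y(Suc i := z)))) \<partial>PiM I (\<lambda>_. unif))
        = ennreal (expected_payoff st k (Suc i) (bar (u(Suc i := z)) (Suc i)))"
        using Suc.IH[OF i', of "u(Suc i := z)"] by (simp add: I_def del: fun_upd_apply)
    qed
    also have "\<dots> = ennreal (expected_payoff st (Suc k) i (bar u i))"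
    proof -
      have b: "bar (u(Suc i := z)) i = bar u i" for z
        by (rule sd_bar_cong) simp
      show ?thesis
      proof (cases "bar u i = dl (Suc i) + 1")
        case True
        then show ?thesis using False by (simp add: sd_bar_Suc[OF Suc.prems] b U.emeasure_space_1[simplified] del: sd_bar.simps)
      next
        case nd: False
        have "(\<integral>\<^sup>+z. ennreal (expected_payoff st k (Suc i) (bar (u(Suc i := z)) (Suc i))) \<partial>unif)
          = (\<integral>\<^sup>+z. (if z \<le> step_w i then ennreal (expected_payoff st k (Suc i) (dl (Suc i)))
              else ennreal (expected_payoff st k (Suc i) (dl (Suc i) + 1))) \<partial>unif)"
          using nd by (intro nn_integral_cong) (simp add: sd_bar_Suc[OF Suc.prems] b del: sd_bar.simps)
        also have "\<dots> = ennreal (expected_payoff st (Suc k) i (bar u i))"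
          using nd False step_w_range[OF Suc.prems] expected_payoff_nonneg[OF i']
          by (simp add: nn_integral_unif_threshold ennreal_mult ennreal_plus)
        finally show ?thesis .
      qed
    qed
    finally show ?thesis unfolding I(1) mg_def .
  qed
qed

text \<open>The recursion starts one index before \<open>i0\<close>, where the bound is the constant
  0, so that the draw at \<open>i0\<close> is itself one of the steps integrated out.\<close>

theorem nn_integral_payoff_le:
  assumes st: "\<And>i d. st i (int (Suc d)) \<Longrightarrow> st i (int d)" and m: "i0 + k \<le> m"
  shows "(\<integral>\<^sup>+u. ennreal (payoff st k i0 u) \<partial>PiM {1..m} (\<lambda>_. unif)) \<le> ennreal \<gamma>"
proof -
  interpret product_prob_space "\<lambda>_::nat. unif"
    by (intro product_prob_spaceI prob_space_unif)
  define i where "i = i0 - 1"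
  have i: "Suc i = i0" using i0_pos by (simp add: i_def)
  define I where "I = {Suc i..i + Suc k}"
  \<comment> \<open>Stopping is suppressed at \<open>i0 - 1\<close>, where the CDF value is not
    controlled by \<gamma>.\<close>
  define st' where "st' j x \<longleftrightarrow> i0 \<le> j \<and> st j x" for j x
  have payoff_st': "payoff st' k j u = payoff st k j u" if "i0 \<le> j" for k j u
    using that by (induction k arbitrary: j) (auto simp: st'_def)
  have I: "I \<subseteq> {1..m}" "finite I" using m i by (auto simp: I_def)
  have payoff: "payoff st k i0 u = payoff st' (Suc k) i (\<lambda>j. if j \<le> i then 0 else restrict u I j)" for u
  proof -
    have "payoff st k i0 u = payoff st' k i0 u" by (simp add: payoff_st')
    also have "\<dots> = payoff st' k i0 (\<lambda>j. if j \<le> i then 0 else restrict u I j)"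
      using i by (intro payoff_cong) (auto simp: I_def)
    also have "\<dots> = payoff st' (Suc k) i (\<lambda>j. if j \<le> i then 0 else restrict u I j)"
      using i by (simp add: st'_def)
    finally show ?thesis .
  qed
  have m: "(\<lambda>y. ennreal (payoff st' (Suc k) i (\<lambda>j. if j \<le> i then 0 else y j))) \<in> borel_measurable (PiM I (\<lambda>_. unif))"
  proof (intro measurable_compose[OF measurable_payoff measurable_ennreal])
    fix j assume j: "1 \<le> j" "j \<le> i + Suc k"
    show "(\<lambda>y. if j \<le> i then 0 else y j) \<in> borel_measurable (PiM I (\<lambda>_. unif))"
    proof (cases "j \<le> i")
      case False
      then have "j \<in> I" using j by (simp add: I_def)
      then have "(\<lambda>y. y j) \<in> measurable (PiM I (\<lambda>_. unif)) unif"
        by (rule measurable_component_singleton)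
      then show ?thesis using False by (simp cong: measurable_cong_sets)
    qed simp
  qed
  have "(\<integral>\<^sup>+u. ennreal (payoff st k i0 u) \<partial>PiM {1..m} (\<lambda>_. unif))
    = (\<integral>\<^sup>+y. ennreal (payoff st' (Suc k) i (\<lambda>j. if j \<le> i then 0 else y j)) \<partial>PiM I (\<lambda>_. unif))"
  proof -
    note D = distr_restrict[OF I(1) finite_atLeastAtMost, symmetric]
    show ?thesis
      using nn_integral_distr[OF measurable_restrict_subset[OF I(1), of "\<lambda>_. unif"], unfolded D, OF m]
      unfolding payoff by (rule sym)
  qed
  also have "\<dots> = ennreal (expected_payoff st' (Suc k) i (bar (\<lambda>_. 0) i))"
    unfolding I_def by (rule nn_integral_payoff) (simp add: i)
  also have "\<dots> \<le> ennreal \<gamma>"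
  proof (rule ennreal_leI)
    have bar0: "bar (\<lambda>_. 0) i = 0" using i by (cases i) auto
    \<comment> \<open>The jump from \<open>-1\<close> makes the first draw use \<open>wt i0\<close>,
      and \<open>0 \<le> dl (Suc i)\<close> keeps the initial 0 from being mistaken for the upper
      bound.\<close>
    have d: "dl i < dl (Suc i)" "0 \<le> dl (Suc i)" using i by (auto simp: sd_delta_def)
    have "expected_payoff st' (Suc k) i 0 = wt i0 * expected_payoff st' k i0 (dl i0) + (1 - wt i0) * expected_payoff st' k i0 (dl i0 + 1)"
      using d i by (simp add: st'_def step_w_def)
    also have "\<dots> \<le> \<gamma>"
      using st by (intro expected_payoff_bounds[THEN conjunct1]) (auto simp: st'_def)
    finally show "expected_payoff st' (Suc k) i (bar (\<lambda>_. 0) i) \<le> \<gamma>" unfolding bar0 .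
  qed
  finally show ?thesis .
qed

end

section \<open>FDP-SD on a ranked list\<close>

lemma score_rank_le: "finite J \<Longrightarrow> score_rank J v p i \<le> card J"
  unfolding score_rank_def by (intro card_mono) auto

lemma score_rank_pos: "finite J \<Longrightarrow> i \<in> J \<Longrightarrow> 1 \<le> score_rank J v p i"
  by (auto simp: score_rank_def Suc_le_eq card_gt_0_iff)

text \<open>Ties are ordered by the injective \<open>p\<close>, so of two distinct indices one
  strictly precedes the other and has strictly fewer predecessors.\<close>

lemma score_rank_inj_on:
  assumes "finite J" "inj_on p J"
  shows "inj_on (score_rank J v p) J"
proof (rule inj_onI, rule ccontr)
  fix i j assume ij: "i \<in> J" "j \<in> J" "score_rank J v p i = score_rank J v p j" "i \<noteq> j"
  define up where "up i = {j \<in> J. v j > v i \<or> v j = v i \<and> p j \<le> p i}" for i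
  have less: "score_rank J v p i < score_rank J v p j"
    if "i \<in> J" "j \<in> J" "v j < v i \<or> v j = v i \<and> p i < p j" for i j
  proof -
    have "up i \<subseteq> up j" using that by (auto simp: up_def)
    moreover have "j \<in> up j" "j \<notin> up i" using that by (auto simp: up_def)
    ultimately have "card (up i) < card (up j)"
      using assms by (intro psubset_card_mono) (auto simp: up_def)
    then show ?thesis by (simp add: up_def score_rank_def)
  qed
  have "p i \<noteq> p j" using ij assms by (auto dest: inj_onD)
  then have "(v j < v i \<or> v j = v i \<and> p i < p j) \<or> (v i < v j \<or> v i = v j \<and> p j < p i)"
    by linarith
  then show False using less[of i j] less[of j i] ij by auto
qed

lemma score_rank_image:
  assumes "finite J" "inj_on p J"
  shows "score_rank J v p ` J = {1..card J}"
proof (rule card_subset_eq)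
  show "score_rank J v p ` J \<subseteq> {1..card J}"
    using score_rank_le[OF assms(1)] score_rank_pos[OF assms(1)] by auto
  show "card (score_rank J v p ` J) = card {1..card J}"
    by (simp add: card_image score_rank_inj_on[OF assms])
qed simp

lemma card_top_ranked:
  assumes "finite J" "inj_on p J" "k \<le> card J"
  shows "card {j \<in> J. score_rank J v p j \<le> k} = k"
proof -
  have "score_rank J v p ` {j \<in> J. score_rank J v p j \<le> k} = {1..k}"
  proof
    show "{1..k} \<subseteq> score_rank J v p ` {j \<in> J. score_rank J v p j \<le> k}"
    proof
      fix r assume r: "r \<in> {1..k}"
      then have "r \<in> score_rank J v p ` J" using assms by (simp add: score_rank_image)
      then show "r \<in> score_rank J v p ` {j \<in> J. score_rank J v p j \<le> k}" using r by auto
    qed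
  qed (use score_rank_pos[OF assms(1)] in auto)
  then have "card (score_rank J v p ` {j \<in> J. score_rank J v p j \<le> k}) = k" by simp
  then show ?thesis
    by (subst (asm) card_image) (auto intro: inj_on_subset[OF score_rank_inj_on[OF assms(1,2)]])
qed

lemma decoy_count_Suc_le:
  assumes "finite J" "inj_on p J"
  shows "decoy_count J l v p (Suc k) \<le> decoy_count J l v p k + 1"
proof -
  let ?r = "score_rank J v p"
  let ?D = "{j \<in> J. ?r j \<le> k \<and> l j = -1}" and ?E = "{j \<in> J. ?r j = Suc k}"
  have "card ?E = card (?r ` ?E)"
    by (subst card_image) (auto intro: inj_on_subset[OF score_rank_inj_on[OF assms]])
  also have "\<dots> \<le> card {Suc k}" by (rule card_mono) auto
  finally have E: "card ?E \<le> 1" by simp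
  have "decoy_count J l v p (Suc k) \<le> card (?D \<union> ?E)"
    unfolding decoy_count_def using assms by (intro card_mono) (auto simp: le_Suc_eq)
  also have "\<dots> \<le> card ?D + card ?E" by (rule card_Un_le)
  finally show ?thesis using E by (simp add: decoy_count_def)
qed

context fdp_sd_params begin

text \<open>Extracts the stopping index hidden in the recursion: the first index at which
  \<open>st\<close> holds, or \<open>i + k\<close> by force.\<close>

lemma payoff_stop:
  "\<exists>t. i \<le> t \<and> t \<le> i + k \<and> payoff st k i u = pv t (nat (bar u t)) \<and>
    (\<forall>j. i \<le> j \<and> j < t \<longrightarrow> \<not> st j (bar u j)) \<and> (t < i + k \<longrightarrow> st t (bar u t))"
proof (induction k arbitrary: i)
  case 0
  show ?case by (intro exI[of _ i]) auto
next
  case (Suc k)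
  show ?case
  proof (cases "st i (bar u i)")
    case True
    then show ?thesis by (intro exI[of _ i]) auto
  next
    case False
    from Suc[of "Suc i"] obtain t where t: "Suc i \<le> t" "t \<le> Suc i + k"
      "payoff st k (Suc i) u = pv t (nat (bar u t))"
      "\<forall>j. Suc i \<le> j \<and> j < t \<longrightarrow> \<not> st j (bar u j)" "t < Suc i + k \<longrightarrow> st t (bar u t)"
      by blast
    have "\<not> st j (bar u j)" if "i \<le> j" "j < t" for j
      using that t(4) False by (cases "j = i") auto
    then show ?thesis using t False by (intro exI[of _ t]) auto
  qed
qed

end

locale ranked_list = fdp_sd_params +
  fixes J N :: "nat set" and l0 :: "nat \<Rightarrow> int" and v :: "nat \<Rightarrow> real" and p :: "nat \<Rightarrow> nat"
  assumes J: "finite J" and p: "inj_on p J"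
begin

abbreviation "rk \<equiv> score_rank J v p"

text \<open>
  The indices among the top \<open>k\<close> that may be decoys: the nulls, and the nonnulls with label \<open>-1\<close>.
\<close>

definition candidates :: "nat \<Rightarrow> nat set" where
  "candidates k = {j \<in> J. rk j \<le> k \<and> (j \<in> N \<or> l0 j = -1)}"

text \<open>
  At a bound \<open>x\<close> with \<open>stops i x\<close> there are at least as many candidates as trials in \<open>sd_p\<close>, so
  the probability of at most \<open>x\<close> decoys among them is at most \<open>sd_p c \<alpha> i x\<close>.
\<close>

definition stops :: "nat \<Rightarrow> int \<Rightarrow> bool" where
  "stops i x \<longleftrightarrow> sd_k \<alpha> i (nat x) + nat x \<le> card (candidates i)"

definition exceeds :: "(nat \<Rightarrow> int) \<Rightarrow> (nat \<Rightarrow> real) \<Rightarrow> bool" where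
  "exceeds l u \<longleftrightarrow> FDP N (fdp_sd c \<alpha> \<gamma> J l v p u) > \<alpha>"

text \<open>By \<open>sd_k_le_Suc\<close> the smaller bound asks for no more candidates. This is the
  monotonicity that \<open>expected_payoff_bounds\<close> demands.\<close>

lemma stops_Suc: "stops i (int (Suc d)) \<Longrightarrow> stops i (int d)"
  using sd_k_le_Suc[of \<alpha> i d] alpha by (simp add: stops_def nat_add_distrib)

lemma finite_candidates: "finite (candidates k)"
  using J by (simp add: candidates_def)

text \<open>
  By maximality of \<open>k = k\<^sub>F\<^sub>D\<^sub>P < card J\<close> the decoy count at \<open>k\<close> equals its bound; with the
  \<open>sd_k\<close> null discoveries this makes \<open>k\<close> a stopping index.
\<close>

lemma exceedsE:
  assumes exceeds: "exceeds l u" and l: "\<And>j. j \<in> J \<Longrightarrow> l j = 1 \<or> l j = -1"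
    and l0: "\<And>j. j \<in> J - N \<Longrightarrow> l j = l0 j"
  obtains k where "i0 \<le> k" "k \<le> card J"
    "\<forall>i. i0 \<le> i \<and> i \<le> k \<longrightarrow> int (decoy_count J l v p i) \<le> bar u i"
    "k < card J \<longrightarrow> stops k (bar u k)"
    "sd_k \<alpha> k (decoy_count J l v p k) + card {j \<in> candidates k. l j = -1} \<le> card (candidates k)"
proof -
  define A where "A = decoy_count J l v p"
  define K where "K = {k \<in> {i0..card J}. \<forall>i\<in>{i0..k}. int (A i) \<le> bar u i}"
  define k where "k = sd_kFDP c \<alpha> \<gamma> J l v p u"
  have k: "k = (if K = {} then 0 else Max K)"
    by (simp only: k_def sd_kFDP_def K_def A_def Let_def)
  define R where "R = {j \<in> J. rk j \<le> k \<and> l j = 1}"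
  have R: "FDP N R > \<alpha>" using exceeds by (simp add: exceeds_def fdp_sd_def R_def k_def)
  have "K \<noteq> {}"
  proof
    assume "K = {}"
    then have "k = 0" using k by simp
    then have "R = {}" using score_rank_pos[OF J, of _ v p] by (fastforce simp: R_def)
    then show False using R alpha by (simp add: FDP_def)
  qed
  moreover have fK: "finite K" by (simp add: K_def)
  ultimately have "k \<in> K" using k by simp
  then have kK: "i0 \<le> k" "k \<le> card J" and A: "\<And>i. i0 \<le> i \<Longrightarrow> i \<le> k \<Longrightarrow> int (A i) \<le> bar u i"
    by (auto simp: K_def)
  define D where "D = {j \<in> J. rk j \<le> k \<and> l j = -1}"
  have A_D: "A k = card D" by (simp add: A_def decoy_count_def D_def)
  have fin: "finite R" "finite D" using J by (auto simp: R_def D_def)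
  have disj: "R \<inter> D = {}" by (auto simp: R_def D_def)
  have "R \<union> D = {j \<in> J. rk j \<le> k}" using l by (auto simp: R_def D_def)
  then have RD: "card R + card D = k"
    using card_top_ranked[OF J p kK(2), of v] card_Un_disjoint[OF fin disj] by simp
  \<comment> \<open>As \<open>card R = k - A k\<close>, an FDP above \<alpha> means more than
    \<open>(k - A k) * \<alpha>\<close> null discoveries; being an integer, their number is at least
    the floor plus 1.\<close>
  have "real (sd_k \<alpha> k (A k)) \<le> real (card (R \<inter> N))"
  proof -
    have "\<alpha> * real (card R) \<le> \<alpha> * real (max (card R) 1)"
      using alpha by (intro mult_left_mono) auto
    also have "\<dots> < real (card (R \<inter> N))"
      using R by (simp add: FDP_def less_divide_eq max_def split: if_splits)
    finally have "\<alpha> * real (card R) < real (card (R \<inter> N))" .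
    moreover have "real (card R) = real k - real (A k)" using RD A_D by linarith
    ultimately have "(real k - real (A k)) * \<alpha> < real (card (R \<inter> N))"
      by (simp add: mult.commute)
    then have "\<lfloor>(real k - real (A k)) * \<alpha>\<rfloor> < int (card (R \<inter> N))"
      by (simp add: floor_less_iff)
    then show ?thesis by (simp add: sd_k_def)
  qed
  then have V: "sd_k \<alpha> k (A k) \<le> card (R \<inter> N)" by simp
  \<comment> \<open>A decoy outside \<open>N\<close> has label \<open>l0\<close>, so all decoys of
    the top \<open>k\<close> are candidates.\<close>
  have decoy: "j \<in> N \<or> l0 j = -1" if "j \<in> J" "l j = -1" for j
    using l0[of j] that by (cases "j \<in> N") auto
  have D_candidates: "D = {j \<in> candidates k. l j = -1}" 
    using decoy by (auto simp: D_def candidates_def)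
  have "R \<inter> N \<union> D \<subseteq> candidates k" using decoy by (auto simp: D_def candidates_def R_def)
  then have "card (R \<inter> N \<union> D) \<le> card (candidates k)" by (rule card_mono[OF finite_candidates])
  moreover have "card (R \<inter> N \<union> D) = card (R \<inter> N) + card D"
    using fin disj by (intro card_Un_disjoint) auto
  ultimately have card_candidates: "sd_k \<alpha> k (A k) + card D \<le> card (candidates k)" using V by simp
  have "stops k (bar u k)" if "k < card J"
  proof -
    have "Suc k \<notin> K" using Max_ge[OF fK, of "Suc k"] k \<open>K \<noteq> {}\<close> by auto
    then have "\<not> int (A (Suc k)) \<le> bar u (Suc k)"
      using that kK A by (auto simp: K_def le_Suc_eq simp del: sd_bar.simps)
    \<comment> \<open>The chain \<open>A k \<le> bar u k \<le> bar u (Suc k) < A (Suc k) \<le> A k +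
      1\<close> pins \<open>bar u k\<close> to \<open>A k\<close>.\<close>
    moreover have "A (Suc k) \<le> A k + 1"
      unfolding A_def by (rule decoy_count_Suc_le[OF J p])
    ultimately have "bar u k = int (A k)"
      using sd_bar_mono[OF kK(1), of u] A[OF kK(1)] by simp
    then show ?thesis using card_candidates A_D by (simp add: stops_def)
  qed
  then show ?thesis
    using that[of k] kK A card_candidates unfolding A_def D_candidates by blast
qed

text \<open>For fixed \<open>u\<close> the stopping index and its candidates are the same for all
  labellings. Up to labellings of weight zero, the error event therefore lies in an event about the
  decoy count of one fixed set, and \<open>decoy_card_dominated\<close> applies. A list shorter than
  \<open>i0\<close> gives no discoveries.\<close>

lemma sum_exceeds_le:
  fixes a :: "nat \<Rightarrow> int \<Rightarrow> real"
  assumes I: "finite I" "J \<subseteq> I" and nonneg: "\<And>i y. i \<in> I \<Longrightarrow> 0 \<le> a i y"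
    and null: "\<And>i. i \<in> J \<inter> N \<Longrightarrow> a i 1 \<le> c * (a i (-1) + a i 1)"
    and nonnull: "\<And>i y. i \<in> J - N \<Longrightarrow> y \<noteq> l0 i \<Longrightarrow> a i y = 0"
  shows "(\<Sum>l\<in>I \<rightarrow>\<^sub>E {-1, 1}. (\<Prod>i\<in>I. a i (l i)) * of_bool (exceeds l u))
    \<le> of_bool (i0 \<le> card J) * payoff stops (card J - i0) i0 u * (\<Prod>i\<in>I. a i (-1) + a i 1)"
proof -
  define Q where "Q = (\<Prod>i\<in>I. a i (-1) + a i 1)"
  have Q: "0 \<le> Q" unfolding Q_def using nonneg by (intro prod_nonneg) auto
  have lab: "(\<forall>j\<in>J. l j = 1 \<or> l j = -1) \<and> (\<forall>j\<in>J - N. l j = l0 j)"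
    if "l \<in> I \<rightarrow>\<^sub>E {-1, 1}" "(\<Prod>i\<in>I. a i (l i)) \<noteq> 0" for l
  proof -
    have "a i (l i) \<noteq> 0" if "i \<in> I" for i
      using that \<open>(\<Prod>i\<in>I. a i (l i)) \<noteq> 0\<close> I by auto
    then have "l i = l0 i" if "i \<in> J - N" for i
      using that nonnull[OF that, of "l i"] I by auto
    moreover have "l j = 1 \<or> l j = -1" if "j \<in> J" for j
      using PiE_mem[OF \<open>l \<in> _\<close>, of j] that I by auto
    ultimately show ?thesis by blast
  qed
  show ?thesis
  proof (cases "i0 \<le> card J")
    case False
    have "(\<Prod>i\<in>I. a i (l i)) * of_bool (exceeds l u) = 0" if "l \<in> I \<rightarrow>\<^sub>E {-1, 1}" for l
    proof (rule ccontr)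
      note l = that
      assume *: "(\<Prod>i\<in>I. a i (l i)) * of_bool (exceeds l u) \<noteq> 0"
      then have "exceeds l u" "(\<Prod>i\<in>I. a i (l i)) \<noteq> 0" by auto
      then obtain k where "i0 \<le> k" "k \<le> card J"
        using lab[OF l] exceedsE[of l u] by metis
      then show False using False by simp
    qed
    then have "(\<Sum>l\<in>I \<rightarrow>\<^sub>E {-1, 1}. (\<Prod>i\<in>I. a i (l i)) * of_bool (exceeds l u)) = 0"
      by (intro sum.neutral) blast
    then show ?thesis using False by simp
  next
    case True
    have "i0 + (card J - i0) = card J" using True by simp
    then obtain t where t: "i0 \<le> t" "t \<le> card J"
      "payoff stops (card J - i0) i0 u = pv t (nat (bar u t))"
      "\<And>j. i0 \<le> j \<Longrightarrow> j < t \<Longrightarrow> \<not> stops j (bar u j)" "t < card J \<Longrightarrow> stops t (bar u t)"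
      using payoff_stop[of i0 "card J - i0" stops u] by metis
    define d where "d = nat (bar u t)"
    define \<kappa> where "\<kappa> = sd_k \<alpha> t d"
    \<comment> \<open>If no index stops, then \<open>t = card J\<close> and the event forces at least \<open>\<kappa>\<close> null targets.\<close>
    define e where "e = (if \<kappa> + d \<le> card (candidates t) then d else card (candidates t) - \<kappa>)"
    have bar: "bar u t = int d" using sd_bar_cases[OF t(1), of u] by (auto simp: d_def)
    have key: "card {j \<in> candidates t. l j = -1} \<le> e \<and> (\<not> \<kappa> + d \<le> card (candidates t) \<longrightarrow> \<kappa> \<le> card (candidates t))"
      if b: "exceeds l u" and l: "\<forall>j\<in>J. l j = 1 \<or> l j = -1" "\<forall>j\<in>J - N. l j = l0 j" for l
    proof -
      obtain k where k: "i0 \<le> k" "k \<le> card J"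
        "\<forall>i. i0 \<le> i \<and> i \<le> k \<longrightarrow> int (decoy_count J l v p i) \<le> bar u i"
        "k < card J \<longrightarrow> stops k (bar u k)"
        "sd_k \<alpha> k (decoy_count J l v p k) + card {j \<in> candidates k. l j = -1} \<le> card (candidates k)"
        by (rule exceedsE[OF b bspec[OF l(1)] bspec[OF l(2)]])
      \<comment> \<open>\<open>k\<close> is itself a stopping index or the end of the list, and
        \<open>t\<close> is the first such index.\<close>
      have "t \<le> k" using t(2,4) k by (meson not_le order_less_le_trans)
      then have "int (decoy_count J l v p t) \<le> bar u t" using k(3) t(1) by blast
      then have A: "decoy_count J l v p t \<le> d" unfolding bar by simp
      have D: "card {j \<in> candidates t. l j = -1} \<le> decoy_count J l v p t"
        unfolding decoy_count_def using J by (intro card_mono) (auto simp: candidates_def)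
      show ?thesis
      proof (cases "\<kappa> + d \<le> card (candidates t)")
        case True
        then show ?thesis using A D by (simp add: e_def)
      next
        case False
        then have "\<not> stops t (bar u t)" by (simp add: stops_def bar \<kappa>_def)
        then have "t = card J" using t(2,5) by force
        then have "k = t" using \<open>t \<le> k\<close> k(2) by simp
        \<comment> \<open>The actual decoy count is at most \<open>d\<close>, so the inequality of
          \<open>exceedsE\<close> leaves at least \<kappa> candidates that are not decoys.\<close>
        moreover have "\<kappa> \<le> sd_k \<alpha> t (decoy_count J l v p t)"
          unfolding \<kappa>_def using alpha A by (intro sd_k_antimono) auto
        ultimately show ?thesis using k(5) False by (simp add: e_def)
      qed
    qed
    show ?thesis
    proof (cases "\<kappa> + d \<le> card (candidates t) \<or> \<kappa> \<le> card (candidates t)")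
      case False
      have "(\<Prod>i\<in>I. a i (l i)) * of_bool (exceeds l u) = 0" if "l \<in> I \<rightarrow>\<^sub>E {-1, 1}" for l
        using key[of l] lab[OF that] False by (cases "(\<Prod>i\<in>I. a i (l i)) = 0") auto
      then have "(\<Sum>l\<in>I \<rightarrow>\<^sub>E {-1, 1}. (\<Prod>i\<in>I. a i (l i)) * of_bool (exceeds l u)) = 0"
        by (intro sum.neutral) blast
      then show ?thesis using Q payoff_nonneg by (simp add: Q_def)
    next
      case kd: True
      \<comment> \<open>With enough candidates, surplus trials only lower the CDF. Otherwise there
        are \<open>\<kappa> + e\<close> candidates, and the missing \<open>d - e\<close> are added
        to trials and allowed successes alike.\<close>
      have le: "binom_cdf (card (candidates t)) (1 - c) e \<le> pv t d"
      proof (cases "\<kappa> + d \<le> card (candidates t)")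
        case True
        then show ?thesis unfolding sd_p_def sd_R_eq \<kappa>_def[symmetric]
          using c by (simp add: e_def binom_cdf_antimono)
      next
        case False
        then have "card (candidates t) + (d - e) = \<kappa> + d" "e + (d - e) = d" using kd by (auto simp: e_def)
        then show ?thesis unfolding sd_p_def sd_R_eq \<kappa>_def[symmetric]
          using binom_cdf_add_le[of "1 - c" "card (candidates t)" e "d - e"] c by simp
      qed
      have "(\<Sum>l\<in>I \<rightarrow>\<^sub>E {-1, 1}. (\<Prod>i\<in>I. a i (l i)) * of_bool (exceeds l u))
        \<le> (\<Sum>l\<in>I \<rightarrow>\<^sub>E {-1, 1}. (\<Prod>i\<in>I. a i (l i)) * of_bool (card {j \<in> candidates t. l j = -1} \<le> e))"
      proof (rule sum_mono)
        fix l assume l: "l \<in> I \<rightarrow>\<^sub>E {-1, 1::int}"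
        have "0 \<le> (\<Prod>i\<in>I. a i (l i))" using nonneg by (intro prod_nonneg) auto
        then show "(\<Prod>i\<in>I. a i (l i)) * of_bool (exceeds l u)
          \<le> (\<Prod>i\<in>I. a i (l i)) * of_bool (card {j \<in> candidates t. l j = -1} \<le> e)"
          using key[of l] lab[OF l] by (cases "(\<Prod>i\<in>I. a i (l i)) = 0") auto
      qed
      also have "\<dots> \<le> binom_cdf (card (candidates t)) (1 - c) e * Q"
        unfolding Q_def
      proof (rule decoy_card_dominated[OF I(1)])
        show "candidates t \<subseteq> I" using I by (auto simp: candidates_def)
        fix i assume "i \<in> candidates t"
        then have i: "i \<in> J" "i \<in> N \<or> l0 i = -1" by (auto simp: candidates_def)
        show "a i 1 \<le> c * (a i (-1) + a i 1)"
        proof (cases "i \<in> N")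
          \<comment> \<open>A nonnull candidate is a sure decoy, since
            \<open>l0 i = -1\<close>.\<close>
          case False
          then have "a i 1 = 0" using i nonnull[of i 1] by auto
          then show ?thesis using i I nonneg c by auto
        qed (use i null in auto)
      qed (use c nonneg in auto)
      also have "\<dots> \<le> pv t d * Q" using le Q by (rule mult_right_mono)
      finally show ?thesis using t(3) True by (simp add: Q_def d_def)
    qed
  qed
qed

text \<open>In \<open>sum_exceeds_le\<close> the uniforms enter only through \<open>payoff\<close>,
  whose integral supplies \<gamma>. The product carried along is the total mass of the weights, in
  the application the probability of \<open>J\<close>.\<close>

lemma nn_integral_exceeds_le:
  fixes a :: "nat \<Rightarrow> int \<Rightarrow> real"
  assumes I: "J \<subseteq> {1..m}" and nonneg: "\<And>i y. i \<in> {1..m} \<Longrightarrow> 0 \<le> a i y"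
    and null: "\<And>i. i \<in> J \<inter> N \<Longrightarrow> a i 1 \<le> c * (a i (-1) + a i 1)"
    and nonnull: "\<And>i y. i \<in> J - N \<Longrightarrow> y \<noteq> l0 i \<Longrightarrow> a i y = 0"
  shows "(\<integral>\<^sup>+u. ennreal (\<Sum>l\<in>{1..m} \<rightarrow>\<^sub>E {-1, 1}. (\<Prod>i\<in>{1..m}. a i (l i)) * of_bool (exceeds l u))
      \<partial>PiM {1..m} (\<lambda>_. unif))
    \<le> ennreal (\<gamma> * (\<Prod>i\<in>{1..m}. a i (-1) + a i 1))"
proof -
  define Q where "Q = (\<Prod>i\<in>{1..m}. a i (-1) + a i 1)"
  have Q: "0 \<le> Q" unfolding Q_def using nonneg by (intro prod_nonneg) auto
  have cJ: "card J \<le> m" using card_mono[OF _ I] by simp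
  have "(\<integral>\<^sup>+u. ennreal (\<Sum>l\<in>{1..m} \<rightarrow>\<^sub>E {-1, 1}. (\<Prod>i\<in>{1..m}. a i (l i)) * of_bool (exceeds l u))
      \<partial>PiM {1..m} (\<lambda>_. unif))
    \<le> (\<integral>\<^sup>+u. ennreal Q * ennreal (of_bool (i0 \<le> card J) * payoff stops (card J - i0) i0 u) \<partial>PiM {1..m} (\<lambda>_. unif))"
  proof (rule nn_integral_mono)
    fix u
    have "ennreal (\<Sum>l\<in>{1..m} \<rightarrow>\<^sub>E {-1, 1}. (\<Prod>i\<in>{1..m}. a i (l i)) * of_bool (exceeds l u))
      \<le> ennreal (of_bool (i0 \<le> card J) * payoff stops (card J - i0) i0 u * Q)"
      unfolding Q_def by (intro ennreal_leI sum_exceeds_le I nonneg null nonnull) auto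
    then show "ennreal (\<Sum>l\<in>{1..m} \<rightarrow>\<^sub>E {-1, 1}. (\<Prod>i\<in>{1..m}. a i (l i)) * of_bool (exceeds l u))
      \<le> ennreal Q * ennreal (of_bool (i0 \<le> card J) * payoff stops (card J - i0) i0 u)"
      using Q payoff_nonneg by (simp add: ennreal_mult mult.commute)
  qed
  also have "\<dots> \<le> ennreal Q * ennreal \<gamma>"
  proof (cases "i0 \<le> card J")
    case True
    have m: "(\<lambda>u. ennreal (payoff stops (card J - i0) i0 u)) \<in> borel_measurable (PiM {1..m} (\<lambda>_. unif))"
    proof (intro measurable_compose[OF measurable_payoff measurable_ennreal])
      fix j assume "1 \<le> j" "j \<le> i0 + (card J - i0)"
      then have "j \<in> {1..m}" using True cJ by simp
      then have "(\<lambda>u. u j) \<in> measurable (PiM {1..m} (\<lambda>_. unif)) unif"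
        by (rule measurable_component_singleton)
      then show "(\<lambda>u. u j) \<in> borel_measurable (PiM {1..m} (\<lambda>_. unif))"
        by (simp cong: measurable_cong_sets)
    qed
    have "(\<integral>\<^sup>+u. ennreal Q * ennreal (of_bool (i0 \<le> card J) * payoff stops (card J - i0) i0 u) \<partial>PiM {1..m} (\<lambda>_. unif))
      = ennreal Q * (\<integral>\<^sup>+u. ennreal (payoff stops (card J - i0) i0 u) \<partial>PiM {1..m} (\<lambda>_. unif))"
      using True m by (simp add: nn_integral_cmult)
    also have "\<dots> \<le> ennreal Q * ennreal \<gamma>"
    proof (rule mult_left_mono)
      show "(\<integral>\<^sup>+u. ennreal (payoff stops (card J - i0) i0 u) \<partial>PiM {1..m} (\<lambda>_. unif)) \<le> ennreal \<gamma>"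
        by (rule nn_integral_payoff_le) (use True cJ stops_Suc in auto)
    qed simp
    finally show ?thesis .
  qed simp
  also have "\<dots> = ennreal (\<gamma> * Q)"
    using Q gamma by (simp add: ennreal_mult mult.commute)
  finally show ?thesis unfolding Q_def .
qed

end

section \<open>Conditioning on the pseudo labels\<close>

lemma measurable_finite_Collect:
  assumes "finite I" "\<And>i. i \<in> I \<Longrightarrow> Measurable.pred \<Omega> (\<lambda>\<omega>. Q \<omega> i)"
  shows "(\<lambda>\<omega>. {i \<in> I. Q \<omega> i}) \<in> measurable \<Omega> (count_space (Pow I))"
proof (subst measurable_count_space_eq2)
  show "finite (Pow I)" using assms by simp
  have "(\<lambda>\<omega>. {i \<in> I. Q \<omega> i}) -` {A} \<inter> space \<Omega> \<in> sets \<Omega>" if "A \<in> Pow I" for A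
  proof -
    have "(\<lambda>\<omega>. {i \<in> I. Q \<omega> i}) -` {A} \<inter> space \<Omega> = {\<omega> \<in> space \<Omega>. \<forall>i\<in>I. Q \<omega> i \<longleftrightarrow> i \<in> A}"
      using that by auto
    also have "\<dots> \<in> sets \<Omega>"
      using assms by (intro sets.sets_Collect_finite_All pred_intros_logic) (auto simp: pred_def intro!: sets.sets_Collect)
    finally show ?thesis .
  qed
  then show "(\<lambda>\<omega>. {i \<in> I. Q \<omega> i}) \<in> space \<Omega> \<rightarrow> Pow I \<and>
      (\<forall>a\<in>Pow I. (\<lambda>\<omega>. {i \<in> I. Q \<omega> i}) -` {a} \<inter> space \<Omega> \<in> sets \<Omega>)" by auto
qed

lemma measurable_card_Collect:
  assumes "finite I" "\<And>i. i \<in> I \<Longrightarrow> Measurable.pred \<Omega> (\<lambda>\<omega>. Q \<omega> i)"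
  shows "(\<lambda>\<omega>. card {i \<in> I. Q \<omega> i}) \<in> measurable \<Omega> (count_space UNIV)"
  by (rule measurable_compose[OF measurable_finite_Collect[OF assms]]) auto

lemma measurable_fdp_sd:
  assumes J: "J \<subseteq> {1..m}"
    and v: "\<And>j. j \<in> J \<Longrightarrow> (\<lambda>\<omega>. v \<omega> j) \<in> borel_measurable \<Omega>"
    and a: "\<And>j. j \<in> {1..m} \<Longrightarrow> (\<lambda>\<omega>. a \<omega> j) \<in> borel_measurable \<Omega>"
  shows "(\<lambda>\<omega>. fdp_sd c \<alpha> \<gamma> J l (v \<omega>) p (a \<omega>)) \<in> measurable \<Omega> (count_space (Pow J))"
proof -
  have fJ: "finite J" and cJ: "card J \<le> m"
    using J card_mono[OF _ J] by (auto intro: finite_subset)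
  have rank[measurable]: "(\<lambda>\<omega>. score_rank J (v \<omega>) p i) \<in> measurable \<Omega> (count_space UNIV)" if "i \<in> J" for i
    unfolding score_rank_def
  proof (rule measurable_card_Collect[OF fJ])
    fix j assume "j \<in> J"
    note [measurable] = v[OF this] v[OF that]
    show "Measurable.pred \<Omega> (\<lambda>\<omega>. v \<omega> i < v \<omega> j \<or> v \<omega> j = v \<omega> i \<and> p j \<le> p i)"
      by measurable
  qed
  have dc[measurable]: "(\<lambda>\<omega>. decoy_count J l (v \<omega>) p k) \<in> measurable \<Omega> (count_space UNIV)" for k
    unfolding decoy_count_def
  proof (rule measurable_card_Collect[OF fJ])
    fix j assume [measurable]: "j \<in> J"
    show "Measurable.pred \<Omega> (\<lambda>\<omega>. score_rank J (v \<omega>) p j \<le> k \<and> l j = -1)"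
      by measurable
  qed
  have bar[measurable]: "(\<lambda>\<omega>. sd_bar c \<alpha> \<gamma> (a \<omega>) i) \<in> measurable \<Omega> (count_space UNIV)" if "i \<le> card J" for i
    using that cJ by (intro measurable_sd_bar a) auto
  have kFDP[measurable]: "(\<lambda>\<omega>. sd_kFDP c \<alpha> \<gamma> J l (v \<omega>) p (a \<omega>)) \<in> measurable \<Omega> (count_space UNIV)"
    unfolding sd_kFDP_def Let_def
  proof (rule measurable_compose[OF measurable_finite_Collect])
    fix k assume k: "k \<in> {sd_i0 c \<alpha> \<gamma>..card J}"
    show "Measurable.pred \<Omega> (\<lambda>\<omega>. \<forall>i\<in>{sd_i0 c \<alpha> \<gamma>..k}. int (decoy_count J l (v \<omega>) p i) \<le> sd_bar c \<alpha> \<gamma> (a \<omega>) i)"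
    proof (intro pred_intros_finite)
      fix i assume "i \<in> {sd_i0 c \<alpha> \<gamma>..k}"
      then have [measurable]: "(\<lambda>\<omega>. sd_bar c \<alpha> \<gamma> (a \<omega>) i) \<in> measurable \<Omega> (count_space UNIV)"
        using k by (intro bar) auto
      show "Measurable.pred \<Omega> (\<lambda>\<omega>. int (decoy_count J l (v \<omega>) p i) \<le> sd_bar c \<alpha> \<gamma> (a \<omega>) i)"
        by measurable
    qed auto
  qed auto
  show ?thesis
    unfolding fdp_sd_def
  proof (rule measurable_finite_Collect[OF fJ])
    fix i assume [measurable]: "i \<in> J"
    show "Measurable.pred \<Omega> (\<lambda>\<omega>. score_rank J (v \<omega>) p i \<le> sd_kFDP c \<alpha> \<gamma> J l (v \<omega>) p (a \<omega>) \<and> l i = 1)"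
      by (rule measurable_compose_countable[OF _ kFDP]) measurable
  qed
qed

lemma pred_FDP_fdp_sd:
  assumes "J \<subseteq> {1..m}"
    and "\<And>j. j \<in> J \<Longrightarrow> (\<lambda>\<omega>. v \<omega> j) \<in> borel_measurable \<Omega>"
    and "\<And>j. j \<in> {1..m} \<Longrightarrow> (\<lambda>\<omega>. a \<omega> j) \<in> borel_measurable \<Omega>"
  shows "Measurable.pred \<Omega> (\<lambda>\<omega>. FDP N (fdp_sd c \<alpha> \<gamma> J l (v \<omega>) p (a \<omega>)) > \<beta>)"
  by (rule measurable_compose[OF measurable_fdp_sd[OF assms]]) auto

lemma measurable_PiM_unif_component:
  "j \<in> I \<Longrightarrow> (\<lambda>u. u j) \<in> borel_measurable (PiM I (\<lambda>_. unif))"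
  using measurable_component_singleton[of j I "\<lambda>_. unif"] by (simp cong: measurable_cong_sets)

definition pseudo_targets :: "nat \<Rightarrow> (nat \<Rightarrow> int) \<Rightarrow> (nat \<Rightarrow> bool) \<Rightarrow> nat set" where
  "pseudo_targets m l t = {i \<in> {1..m}. \<not> (l i = -1 \<and> t i)}"

text \<open>A null with target probability \<open>q\<close> stays in \<open>J\<close> with
  probability \<open>(1 - q) * (1 - s) + q\<close>. Its target probability within \<open>J\<close>
  is the quotient, which increases in \<open>q\<close> and equals \<open>c\<close> at
  \<open>q = c0\<close>.\<close>

lemma effective_c:
  fixes s c0 :: real
  assumes s: "0 \<le> s" "s < 1" and c0: "0 < c0" "c0 < 1"
  defines "c \<equiv> c0 / (1 - s * (1 - c0))"
  shows "0 < c" "c < 1" "\<And>q. q \<le> c0 \<Longrightarrow> q \<le> c * ((1 - q) * (1 - s) + q)"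
proof -
  have "s * (1 - c0) \<le> s * 1" using s c0 by (intro mult_left_mono) auto
  then have pos: "0 < 1 - s * (1 - c0)" using s by linarith
  then show "0 < c" using c0 by (simp add: c_def)
  have "c0 * (1 - s) < 1 * (1 - s)" using s c0 by (intro mult_strict_right_mono) auto
  then show "c < 1" using pos by (simp add: c_def algebra_simps)
  fix q assume "q \<le> c0"
  \<comment> \<open>Both sides of the next inequality contain \<open>c0 * q * s\<close>; this is
    what remains after cancelling it.\<close>
  then have "q * (1 - s) \<le> c0 * (1 - s)" using s by (intro mult_right_mono) auto
  then have "q * (1 - s * (1 - c0)) \<le> c0 * ((1 - q) * (1 - s) + q)"
    by (simp add: algebra_simps)
  then show "q \<le> c * ((1 - q) * (1 - s) + q)"
    using pos by (simp add: c_def pos_le_divide_eq)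
qed

lemma prod_of_bool: 
  "finite I \<Longrightarrow> (\<Prod>i\<in>I. of_bool (Q i) * (f i :: real)) = of_bool (\<forall>i\<in>I. Q i) * (\<Prod>i\<in>I. f i)"
  by (induction I rule: finite_induct) auto

text \<open>
  The error bound for fixed scores, side information and nonnull labels \<open>l0\<close>: conditionally on the
  set \<open>J\<close> of pseudo targets the labels are still independent, now with target probabilities at
  most \<open>c\<close> on the nulls, and the score vector \<open>v J\<close> is a constant.
\<close>

lemma nn_integral_labels_coins_le:
  fixes s c0 \<alpha> \<gamma> :: real and q :: "nat \<Rightarrow> int \<Rightarrow> real" and v :: "nat set \<Rightarrow> nat \<Rightarrow> real"
  assumes s: "0 \<le> s" "s < 1" and c0: "0 < c0" "c0 < 1"
    and alpha: "0 < \<alpha>" "\<alpha> < 1" and gamma: "0 < \<gamma>" "\<gamma> < 1"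
    and p: "inj_on p {1..m}"
    and q_nonneg: "\<And>i y. i \<in> {1..m} \<Longrightarrow> 0 \<le> q i y"
    and q_sum: "\<And>i. i \<in> {1..m} \<Longrightarrow> q i (-1) + q i 1 = 1"
    and q_null: "\<And>i. i \<in> N \<Longrightarrow> q i 1 \<le> c0"
    and q_nonnull: "\<And>i y. i \<in> {1..m} - N \<Longrightarrow> y \<noteq> l0 i \<Longrightarrow> q i y = 0"
  defines "c \<equiv> c0 / (1 - s * (1 - c0))"
  shows "(\<integral>\<^sup>+u. ennreal (\<Sum>l\<in>{1..m} \<rightarrow>\<^sub>E {-1, 1}. \<Sum>t\<in>{1..m} \<rightarrow>\<^sub>E UNIV.
      (\<Prod>i\<in>{1..m}. q i (l i)) * (\<Prod>i\<in>{1..m}. pmf (bernoulli_pmf s) (t i)) *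
      of_bool (FDP N (fdp_sd c \<alpha> \<gamma> (pseudo_targets m l t) l (v (pseudo_targets m l t)) p u) > \<alpha>))
    \<partial>PiM {1..m} (\<lambda>_. unif)) \<le> ennreal \<gamma>"
proof -
  define I where "I = {1..m}"
  have fI: "finite I" by (simp add: I_def)
  note eff = effective_c[OF s c0, folded c_def]
  \<comment> \<open>The probability that the coin of \<open>i\<close> produces the membership
    prescribed by \<open>J\<close> when its label is \<open>y\<close>; \<open>a\<close> multiplies
    it by the label probability.\<close>
  define b where "b J i y = (\<Sum>x\<in>UNIV. of_bool ((i \<in> J) = (\<not> (y = -1 \<and> x))) * pmf (bernoulli_pmf s) x)"
    for J :: "nat set" and i :: nat and y :: int
  define a where "a J i y = q i y * b J i y" for J i y
  define E where "E J l u \<longleftrightarrow> FDP N (fdp_sd c \<alpha> \<gamma> J l (v J) p u) > \<alpha>" for J l u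
  have b1: "b J i 1 = of_bool (i \<in> J)" and b2: "b J i (-1) = (if i \<in> J then 1 - s else s)" for J i
    using s by (auto simp: b_def UNIV_bool)
  have b_nonneg: "0 \<le> b J i y" for J i y
    unfolding b_def by (intro sum_nonneg) auto
  have PT: "pseudo_targets m l t \<in> Pow I" for l t
    by (auto simp: pseudo_targets_def I_def)
  \<comment> \<open>The coins enter the event only through \<open>J\<close>, and the condition that
    they produce a given \<open>J\<close> factorizes over the indices.\<close>
  have coins: "(\<Sum>t\<in>I \<rightarrow>\<^sub>E UNIV. (\<Prod>i\<in>I. q i (l i)) * (\<Prod>i\<in>I. pmf (bernoulli_pmf s) (t i)) *
      of_bool (E (pseudo_targets m l t) l u))
    = (\<Sum>J\<in>Pow I. (\<Prod>i\<in>I. a J i (l i)) * of_bool (E J l u))" for l u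
  proof -
    have "(\<Sum>t\<in>I \<rightarrow>\<^sub>E UNIV. (\<Prod>i\<in>I. q i (l i)) * (\<Prod>i\<in>I. pmf (bernoulli_pmf s) (t i)) *
        of_bool (E (pseudo_targets m l t) l u))
      = (\<Sum>t\<in>I \<rightarrow>\<^sub>E UNIV. \<Sum>J\<in>Pow I. of_bool (J = pseudo_targets m l t) *
          ((\<Prod>i\<in>I. q i (l i)) * (\<Prod>i\<in>I. pmf (bernoulli_pmf s) (t i)) * of_bool (E J l u)))"
    proof (rule sum.cong[OF refl])
      fix t :: "nat \<Rightarrow> bool"
      show "(\<Prod>i\<in>I. q i (l i)) * (\<Prod>i\<in>I. pmf (bernoulli_pmf s) (t i)) * of_bool (E (pseudo_targets m l t) l u)
        = (\<Sum>J\<in>Pow I. of_bool (J = pseudo_targets m l t) *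
          ((\<Prod>i\<in>I. q i (l i)) * (\<Prod>i\<in>I. pmf (bernoulli_pmf s) (t i)) * of_bool (E J l u)))"
        using PT[of l t] fI by (subst sum.remove[of _ "pseudo_targets m l t"]) (auto intro!: sum.neutral)
    qed
    also have "\<dots> = (\<Sum>J\<in>Pow I. \<Sum>t\<in>I \<rightarrow>\<^sub>E UNIV. of_bool (J = pseudo_targets m l t) *
          ((\<Prod>i\<in>I. q i (l i)) * (\<Prod>i\<in>I. pmf (bernoulli_pmf s) (t i)) * of_bool (E J l u)))"
      by (rule sum.swap)
    also have "\<dots> = (\<Sum>J\<in>Pow I. (\<Prod>i\<in>I. a J i (l i)) * of_bool (E J l u))"
    proof (rule sum.cong[OF refl])
      fix J assume J: "J \<in> Pow I"
      have eq: "J = pseudo_targets m l t \<longleftrightarrow> (\<forall>i\<in>I. (i \<in> J) = (\<not> (l i = -1 \<and> t i)))" for t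
        using J by (auto simp: pseudo_targets_def I_def)
      have "(\<Sum>t\<in>I \<rightarrow>\<^sub>E UNIV. of_bool (J = pseudo_targets m l t) * (\<Prod>i\<in>I. pmf (bernoulli_pmf s) (t i)))
        = (\<Sum>t\<in>I \<rightarrow>\<^sub>E UNIV. \<Prod>i\<in>I. of_bool ((i \<in> J) = (\<not> (l i = -1 \<and> t i))) * pmf (bernoulli_pmf s) (t i))"
        unfolding eq by (simp only: prod_of_bool[OF fI])
      also have "\<dots> = (\<Prod>i\<in>I. b J i (l i))"
        unfolding b_def by (rule prod_sum_PiE[symmetric]) (use fI in auto)
      finally have *: "(\<Sum>t\<in>I \<rightarrow>\<^sub>E UNIV. of_bool (J = pseudo_targets m l t) * (\<Prod>i\<in>I. pmf (bernoulli_pmf s) (t i)))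
        = (\<Prod>i\<in>I. b J i (l i))" .
      have "(\<Sum>t\<in>I \<rightarrow>\<^sub>E UNIV. of_bool (J = pseudo_targets m l t) *
          ((\<Prod>i\<in>I. q i (l i)) * (\<Prod>i\<in>I. pmf (bernoulli_pmf s) (t i)) * of_bool (E J l u)))
        = (\<Sum>t\<in>I \<rightarrow>\<^sub>E UNIV. of_bool (J = pseudo_targets m l t) * (\<Prod>i\<in>I. pmf (bernoulli_pmf s) (t i)))
          * ((\<Prod>i\<in>I. q i (l i)) * of_bool (E J l u))"
        unfolding sum_distrib_right by (intro sum.cong refl) (simp only: mult_ac)
      also have "\<dots> = (\<Prod>i\<in>I. a J i (l i)) * of_bool (E J l u)"
        unfolding * a_def by (simp add: prod.distrib mult_ac)
      finally show "(\<Sum>t\<in>I \<rightarrow>\<^sub>E UNIV. of_bool (J = pseudo_targets m l t) *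
          ((\<Prod>i\<in>I. q i (l i)) * (\<Prod>i\<in>I. pmf (bernoulli_pmf s) (t i)) * of_bool (E J l u)))
        = (\<Prod>i\<in>I. a J i (l i)) * of_bool (E J l u)" .
    qed
    finally show ?thesis .
  qed
  have a_nonneg: "0 \<le> a J i y" if "i \<in> I" for J i y
    using q_nonneg[of i y] b_nonneg that by (simp add: a_def I_def)
  have S_nonneg: "0 \<le> (\<Sum>l\<in>I \<rightarrow>\<^sub>E {-1, 1}. (\<Prod>i\<in>I. a J i (l i)) * of_bool (E J l u))" for J u
    by (intro sum_nonneg mult_nonneg_nonneg prod_nonneg) (auto simp: a_nonneg)
  have J_bound: "(\<integral>\<^sup>+u. ennreal (\<Sum>l\<in>I \<rightarrow>\<^sub>E {-1, 1}. (\<Prod>i\<in>I. a J i (l i)) * of_bool (E J l u))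
      \<partial>PiM I (\<lambda>_. unif)) \<le> ennreal (\<gamma> * (\<Prod>i\<in>I. a J i (-1) + a J i 1))" if JI: "J \<in> Pow I" for J
  proof -
    interpret ranked_list c \<alpha> \<gamma> J N l0 "v J" p
      using eff alpha gamma JI p fI inj_on_subset[OF p, of J]
      by unfold_locales (auto simp: I_def intro: finite_subset)
    show ?thesis
      unfolding E_def exceeds_def[symmetric] I_def
    proof (rule nn_integral_exceeds_le)
      fix i assume i: "i \<in> J \<inter> N"
      then have "i \<in> {1..m}" using JI by (auto simp: I_def)
      then have "q i (-1) = 1 - q i 1" using q_sum by fastforce
      then show "a J i 1 \<le> c * (a J i (-1) + a J i 1)"
        using i eff(3)[of "q i 1"] q_null[of i] by (simp add: a_def b1 b2)
    next
      fix i y assume "i \<in> J - N" "y \<noteq> l0 i"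
      then show "a J i y = 0" using JI q_nonnull[of i y] by (auto simp: a_def I_def)
    qed (use JI a_nonneg in \<open>auto simp: I_def\<close>)
  qed
  have "(\<integral>\<^sup>+u. ennreal (\<Sum>l\<in>I \<rightarrow>\<^sub>E {-1, 1}. \<Sum>t\<in>I \<rightarrow>\<^sub>E UNIV.
      (\<Prod>i\<in>I. q i (l i)) * (\<Prod>i\<in>I. pmf (bernoulli_pmf s) (t i)) * of_bool (E (pseudo_targets m l t) l u))
    \<partial>PiM I (\<lambda>_. unif))
    = (\<integral>\<^sup>+u. (\<Sum>J\<in>Pow I. ennreal (\<Sum>l\<in>I \<rightarrow>\<^sub>E {-1, 1}. (\<Prod>i\<in>I. a J i (l i)) * of_bool (E J l u)))
    \<partial>PiM I (\<lambda>_. unif))"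
    unfolding coins
    by (subst sum.swap) (simp add: sum_ennreal S_nonneg)
  also have "\<dots> = (\<Sum>J\<in>Pow I. \<integral>\<^sup>+u. ennreal (\<Sum>l\<in>I \<rightarrow>\<^sub>E {-1, 1}. (\<Prod>i\<in>I. a J i (l i)) * of_bool (E J l u))
    \<partial>PiM I (\<lambda>_. unif))"
  proof (rule nn_integral_sum)
    fix J assume "J \<in> Pow I"
    then have [measurable]: "Measurable.pred (PiM I (\<lambda>_. unif)) (\<lambda>u. E J l u)" for l
      unfolding E_def I_def by (intro pred_FDP_fdp_sd[where m = m] measurable_PiM_unif_component) auto
    show "(\<lambda>u. ennreal (\<Sum>l\<in>I \<rightarrow>\<^sub>E {-1, 1}. (\<Prod>i\<in>I. a J i (l i)) * of_bool (E J l u)))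
      \<in> borel_measurable (PiM I (\<lambda>_. unif))"
      by measurable
  qed
  also have "\<dots> \<le> (\<Sum>J\<in>Pow I. ennreal (\<gamma> * (\<Prod>i\<in>I. a J i (-1) + a J i 1)))"
    by (intro sum_mono J_bound)
  also have "\<dots> = ennreal (\<gamma> * (\<Sum>J\<in>Pow I. \<Prod>i\<in>I. a J i (-1) + a J i 1))"
    unfolding sum_distrib_left using gamma
    by (intro sum_ennreal mult_nonneg_nonneg prod_nonneg add_nonneg_nonneg a_nonneg) auto
  also have "(\<Sum>J\<in>Pow I. \<Prod>i\<in>I. a J i (-1) + a J i 1) = 1"
  proof -
    \<comment> \<open>\<open>f i\<close> and \<open>g i\<close> are the masses of \<open>i\<close>
      inside and outside \<open>J\<close>. They add up to 1, so expanding the product of the sums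
      shows that the probabilities of all \<open>J\<close> add up to 1.\<close>
    define f where "f i = q i (-1) * (1 - s) + q i 1" for i
    define g where "g i = q i (-1) * s" for i
    have "(\<Sum>J\<in>Pow I. \<Prod>i\<in>I. a J i (-1) + a J i 1) = (\<Sum>J\<in>Pow I. prod f J * prod g (I - J))"
    proof (rule sum.cong[OF refl])
      fix J assume "J \<in> Pow I"
      then have JI: "I \<inter> J = J" "I \<inter> - J = I - J" by auto
      have "(\<Prod>i\<in>I. a J i (-1) + a J i 1) = (\<Prod>i\<in>I. if i \<in> J then f i else g i)"
        by (intro prod.cong) (auto simp: a_def b1 b2 f_def g_def)
      then show "(\<Prod>i\<in>I. a J i (-1) + a J i 1) = prod f J * prod g (I - J)"
        by (simp add: prod.If_cases[OF fI] JI)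
    qed
    also have "\<dots> = (\<Prod>i\<in>I. f i + g i)" by (rule prod_add[OF fI, symmetric])
    also have "\<dots> = 1"
      using q_sum by (intro prod.neutral) (auto simp: f_def g_def I_def algebra_simps)
    finally show ?thesis .
  qed
  finally show ?thesis unfolding I_def E_def by simp
qed

section \<open>The law of the internal randomness\<close>

text \<open>A finite product of finite discrete spaces is discrete, so a whole vector of labels or
  coins can be treated as one variable with finitely many values.\<close>

lemma measurable_PiM_count_space:
  assumes "finite I" "\<And>i. i \<in> I \<Longrightarrow> finite (A i)" "\<And>i. i \<in> I \<Longrightarrow> space (K i) = A i"
    "\<And>i a. i \<in> I \<Longrightarrow> a \<in> A i \<Longrightarrow> {a} \<in> sets (K i)"
  shows "(\<lambda>x. x) \<in> measurable (PiM I K) (count_space (PiE I A))"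
proof (subst measurable_count_space_eq2)
  show "finite (PiE I A)" using assms by (intro finite_PiE) auto
  have sp: "space (PiM I K) = PiE I A"
    using assms by (auto simp: space_PiM intro!: PiE_cong)
  have "(\<lambda>x. x) -` {g} \<inter> space (PiM I K) \<in> sets (PiM I K)" if g: "g \<in> PiE I A" for g
  proof -
    have "(\<lambda>x. x) -` {g} \<inter> space (PiM I K) = PiE I (\<lambda>i. {g i})"
      using g PiE_singleton[of g I] by (auto simp: sp PiE_iff)
    also have "\<dots> \<in> sets (PiM I K)"
      using assms(4)[OF _ PiE_mem[OF g]] by (intro sets_PiM_I_finite assms(1)) auto
    finally show ?thesis .
  qed
  then show "(\<lambda>x. x) \<in> space (PiM I K) \<rightarrow> PiE I A \<and>
      (\<forall>a\<in>PiE I A. (\<lambda>x. x) -` {a} \<inter> space (PiM I K) \<in> sets (PiM I K))"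
    using sp by auto
qed

lemma measurable_PiM_label_space:
  "finite I \<Longrightarrow> (\<lambda>x. x) \<in> measurable (PiM I (\<lambda>_. label_space)) (count_space (I \<rightarrow>\<^sub>E {-1, 1}))"
  by (intro measurable_PiM_count_space) auto

lemma measurable_PiM_bernoulli:
  "finite I \<Longrightarrow> (\<lambda>x. x) \<in> measurable (PiM I (\<lambda>_. measure_pmf (bernoulli_pmf s))) (count_space (I \<rightarrow>\<^sub>E UNIV))"
  by (intro measurable_PiM_count_space) auto

lemma nn_integral_PiM_bernoulli:
  assumes I: "finite I"
  shows "(\<integral>\<^sup>+t. F t \<partial>PiM I (\<lambda>_. measure_pmf (bernoulli_pmf s))) =
    (\<Sum>t\<in>I \<rightarrow>\<^sub>E UNIV. ennreal (\<Prod>i\<in>I. pmf (bernoulli_pmf s) (t i)) * F t)"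
proof -
  let ?K = "PiM I (\<lambda>_. measure_pmf (bernoulli_pmf s))"
  interpret finite_product_sigma_finite "\<lambda>_. measure_pmf (bernoulli_pmf s)" I
    by unfold_locales (rule I)
  have fin: "finite (I \<rightarrow>\<^sub>E (UNIV :: bool set))" using I by (intro finite_PiE) auto
  have sp: "space ?K = I \<rightarrow>\<^sub>E UNIV" by (simp add: space_PiM)
  have em: "emeasure ?K {t} = ennreal (\<Prod>i\<in>I. pmf (bernoulli_pmf s) (t i))" "{t} \<in> sets ?K"
    if t: "t \<in> I \<rightarrow>\<^sub>E UNIV" for t
  proof -
    have t': "{t} = PiE I (\<lambda>i. {t i})" using t PiE_singleton[of t I] by (simp add: PiE_iff)
    show "{t} \<in> sets ?K" unfolding t' by (intro sets_PiM_I_finite I) auto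
    show "emeasure ?K {t} = ennreal (\<Prod>i\<in>I. pmf (bernoulli_pmf s) (t i))"
      unfolding t' by (subst emeasure_PiM[OF I]) (auto simp: emeasure_pmf_single prod_ennreal)
  qed
  have "(\<integral>\<^sup>+t. F t \<partial>?K) = (\<integral>\<^sup>+t. (\<Sum>t'\<in>I \<rightarrow>\<^sub>E UNIV. F t' * indicator {t'} t) \<partial>?K)"
  proof (rule nn_integral_cong)
    fix t assume "t \<in> space ?K"
    then have "t \<in> I \<rightarrow>\<^sub>E UNIV" by (simp add: sp)
    then show "F t = (\<Sum>t'\<in>I \<rightarrow>\<^sub>E UNIV. F t' * indicator {t'} t)"
      using fin by (subst sum.remove[of _ t]) (auto intro!: sum.neutral)
  qed
  also have "\<dots> = (\<Sum>t'\<in>I \<rightarrow>\<^sub>E UNIV. \<integral>\<^sup>+t. F t' * indicator {t'} t \<partial>?K)"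
    using em by (intro nn_integral_sum) auto
  also have "\<dots> = (\<Sum>t\<in>I \<rightarrow>\<^sub>E UNIV. ennreal (\<Prod>i\<in>I. pmf (bernoulli_pmf s) (t i)) * F t)"
    using em by (intro sum.cong refl) (simp add: nn_integral_cmult_indicator mult.commute)
  finally show ?thesis .
qed

text \<open>Pseudo labels amount to membership in \<open>J\<close>. In this form the scores, for
  fixed data and \<open>z\<close>, visibly depend on the labels through \<open>J\<close>
  alone.\<close>

lemma reset_fdx_eq:
  "reset_fdx m \<alpha> \<gamma> s c0 f l w x t z p u =
    fdp_sd (c0 / (1 - s * (1 - c0))) \<alpha> \<gamma> (pseudo_targets m l t) l
      (f (\<lambda>i\<in>{1..m}. (w i, x i, if i \<in> pseudo_targets m l t then 1 else -1)) z) p u"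
proof -
  have J: "{i \<in> {1..m}. pseudo_label l t i = 1} = pseudo_targets m l t"
    by (auto simp: pseudo_label_def pseudo_targets_def)
  have "(\<lambda>i\<in>{1..m}. (w i, x i, pseudo_label l t i)) =
      (\<lambda>i\<in>{1..m}. (w i, x i, if i \<in> pseudo_targets m l t then 1 else -1))"
    by (intro restrict_ext) (auto simp: pseudo_label_def pseudo_targets_def)
  then show ?thesis by (simp only: reset_fdx_def Let_def J)
qed

lemma fdp_sd_cong:
  assumes J: "J \<subseteq> {1..m}" and l: "\<And>i. i \<in> J \<Longrightarrow> l i = l' i"
    and u: "\<And>i. i \<in> {1..m} \<Longrightarrow> u i = u' i"
  shows "fdp_sd c \<alpha> \<gamma> J l v p u = fdp_sd c \<alpha> \<gamma> J l' v p u'"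
proof -
  have dc: "decoy_count J l v p k = decoy_count J l' v p k" for k
    unfolding decoy_count_def using l by (intro arg_cong[of _ _ card]) auto
  have cJ: "card J \<le> m" using card_mono[OF _ J] by simp
  have bar: "sd_bar c \<alpha> \<gamma> u i = sd_bar c \<alpha> \<gamma> u' i" if "i \<le> m" for i
    using that u by (induction i) (simp_all add: Let_def)
  have "{k \<in> {sd_i0 c \<alpha> \<gamma>..card J}. \<forall>i\<in>{sd_i0 c \<alpha> \<gamma>..k}. int (decoy_count J l v p i) \<le> sd_bar c \<alpha> \<gamma> u i}
    = {k \<in> {sd_i0 c \<alpha> \<gamma>..card J}. \<forall>i\<in>{sd_i0 c \<alpha> \<gamma>..k}. int (decoy_count J l' v p i) \<le> sd_bar c \<alpha> \<gamma> u' i}"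
    using cJ by (intro Collect_cong conj_cong ball_cong refl) (simp add: dc bar)
  then have "sd_kFDP c \<alpha> \<gamma> J l v p u = sd_kFDP c \<alpha> \<gamma> J l' v p u'"
    unfolding sd_kFDP_def by (simp only:)
  then show ?thesis using l by (auto simp: fdp_sd_def)
qed

text \<open>Bridges the unrestricted functions in the final statement and the vectors restricted to
  \<open>{1..m}\<close> on which the laws are defined.\<close>

lemma reset_fdx_cong:
  assumes "\<And>i. i \<in> {1..m} \<Longrightarrow> l i = l' i" "\<And>i. i \<in> {1..m} \<Longrightarrow> w i = w' i" "\<And>i. i \<in> {1..m} \<Longrightarrow> x i = x' i"
    "\<And>i. i \<in> {1..m} \<Longrightarrow> t i = t' i" "\<And>i. i \<in> {1..m} \<Longrightarrow> u i = u' i"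
  shows "reset_fdx m \<alpha> \<gamma> s c0 f l w x t z p u = reset_fdx m \<alpha> \<gamma> s c0 f l' w' x' t' z p u'"
proof -
  have PT: "pseudo_targets m l t = pseudo_targets m l' t'"
    using assms by (auto simp: pseudo_targets_def)
  have "(\<lambda>i\<in>{1..m}. (w i, x i, if i \<in> J then 1 else -1)) = (\<lambda>i\<in>{1..m}. (w' i, x' i, if i \<in> J then 1 else (-1::int)))" for J
    using assms by (intro restrict_ext) auto
  then show ?thesis
    unfolding reset_fdx_eq PT
    by (simp only:) (rule fdp_sd_cong[of _ m], use assms in \<open>auto simp: pseudo_targets_def\<close>)
qed

locale reset_model =
  fixes MX :: "'x measure" and MZ :: "'z measure" and m :: nat and N :: "nat set"
    and \<alpha> \<gamma> s c0 :: real and f :: "(nat \<Rightarrow> real \<times> 'x \<times> int) \<Rightarrow> 'z \<Rightarrow> nat \<Rightarrow> real"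
  assumes MZ: "prob_space MZ"
    and alpha: "0 < \<alpha>" "\<alpha> < 1" and gamma: "0 < \<gamma>" "\<gamma> < 1"
    and s: "0 \<le> s" "s < 1" and c0: "0 < c0" "c0 < 1"
    and N: "N \<subseteq> {1..m}"
    and f: "(\<lambda>(y, z). f y z) \<in>
         measurable ((\<Pi>\<^sub>M i\<in>{1..m}. borel \<Otimes>\<^sub>M (MX \<Otimes>\<^sub>M label_space)) \<Otimes>\<^sub>M MZ)
                    (\<Pi>\<^sub>M i\<in>{1..m}. borel)"
begin

abbreviation "I \<equiv> {1..m}"
abbreviation "SY \<equiv> \<Pi>\<^sub>M i\<in>I. (borel :: real measure) \<Otimes>\<^sub>M MX"
abbreviation "coins \<equiv> \<Pi>\<^sub>M i\<in>I. measure_pmf (bernoulli_pmf s)"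
abbreviation "perms \<equiv> uniform_count_measure {p. p permutes I}"
abbreviation "unifs \<equiv> \<Pi>\<^sub>M i\<in>I. unif"

text \<open>The labels are a separate argument so that they can be varied while scores, side
  information and seed stay fixed.\<close>

definition excess ::
  "(nat \<Rightarrow> int) \<Rightarrow> (nat \<Rightarrow> real \<times> 'x) \<Rightarrow> ((nat \<Rightarrow> bool) \<times> 'z \<times> (nat \<Rightarrow> nat) \<times> (nat \<Rightarrow> real)) \<Rightarrow> bool" where
  "excess l y = (\<lambda>(t, z, p, u).
     FDP N (reset_fdx m \<alpha> \<gamma> s c0 f l (\<lambda>i. fst (y i)) (\<lambda>i. snd (y i)) t z p u) > \<alpha>)"

text \<open>Labels, coins and permutations take finitely many values and can be frozen one after the
  other; then only the scores and the uniforms vary.\<close>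

lemma pred_excess:
  assumes l: "lf \<in> measurable \<Omega> (count_space (I \<rightarrow>\<^sub>E {-1, 1}))"
    and y: "yf \<in> measurable \<Omega> SY"
    and sd: "sf \<in> measurable \<Omega> (seed_law m s MZ)"
  shows "Measurable.pred \<Omega> (\<lambda>\<omega>. excess (lf \<omega>) (yf \<omega>) (sf \<omega>))"
proof -
  note sd' = sd[unfolded seed_law_def]
  have t0: "(\<lambda>\<omega>. fst (sf \<omega>)) \<in> measurable \<Omega> coins"
    using measurable_compose[OF sd' measurable_fst] .
  have z: "(\<lambda>\<omega>. fst (snd (sf \<omega>))) \<in> measurable \<Omega> MZ"
    using measurable_compose[OF measurable_compose[OF sd' measurable_snd] measurable_fst] .
  have p0: "(\<lambda>\<omega>. fst (snd (snd (sf \<omega>)))) \<in> measurable \<Omega> perms"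
    using measurable_compose[OF measurable_compose[OF measurable_compose[OF sd' measurable_snd] measurable_snd] measurable_fst] .
  have u: "(\<lambda>\<omega>. snd (snd (snd (sf \<omega>)))) \<in> measurable \<Omega> unifs"
    using measurable_compose[OF measurable_compose[OF measurable_compose[OF sd' measurable_snd] measurable_snd] measurable_snd] .
  have t: "(\<lambda>\<omega>. fst (sf \<omega>)) \<in> measurable \<Omega> (count_space (I \<rightarrow>\<^sub>E UNIV))"
    using measurable_compose[OF t0 measurable_PiM_bernoulli] by simp
  have p: "(\<lambda>\<omega>. fst (snd (snd (sf \<omega>)))) \<in> measurable \<Omega> (count_space {p. p permutes I})"
    using p0 by (simp only: measurable_cong_sets[OF refl sets_uniform_count_measure_count_space])
  have fixed: "Measurable.pred \<Omega> (\<lambda>\<omega>. FDP N (reset_fdx m \<alpha> \<gamma> s c0 f l (\<lambda>i. fst (yf \<omega> i)) (\<lambda>i. snd (yf \<omega> i)) t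
      (fst (snd (sf \<omega>))) p (snd (snd (snd (sf \<omega>))))) > \<alpha>)" for l t p
    unfolding reset_fdx_eq
  proof (rule pred_FDP_fdp_sd[where m = m])
    show PT: "pseudo_targets m l t \<subseteq> {1..m}" by (auto simp: pseudo_targets_def)
    let ?J = "pseudo_targets m l t"
    fix j assume "j \<in> ?J"
    then have j: "j \<in> I" using PT by auto
    have arg: "(\<lambda>\<omega>. \<lambda>i\<in>I. (fst (yf \<omega> i), snd (yf \<omega> i), if i \<in> ?J then 1 else -1))
      \<in> measurable \<Omega> (\<Pi>\<^sub>M i\<in>I. borel \<Otimes>\<^sub>M (MX \<Otimes>\<^sub>M label_space))"
    proof (rule measurable_restrict)
      fix i assume "i \<in> I"
      then have yi: "(\<lambda>\<omega>. yf \<omega> i) \<in> measurable \<Omega> (borel \<Otimes>\<^sub>M MX)"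
        using measurable_compose[OF y measurable_component_singleton] by auto
      show "(\<lambda>\<omega>. (fst (yf \<omega> i), snd (yf \<omega> i), if i \<in> ?J then 1 else -1))
        \<in> measurable \<Omega> (borel \<Otimes>\<^sub>M (MX \<Otimes>\<^sub>M label_space))"
        by (intro measurable_Pair measurable_compose[OF yi measurable_fst]
            measurable_compose[OF yi measurable_snd] measurable_const) auto
    qed
    have "(\<lambda>\<omega>. f (\<lambda>i\<in>I. (fst (yf \<omega> i), snd (yf \<omega> i), if i \<in> ?J then 1 else -1)) (fst (snd (sf \<omega>))))
      \<in> measurable \<Omega> (\<Pi>\<^sub>M i\<in>I. borel)"
      using measurable_compose[OF measurable_Pair[OF arg z] f] by simp
    from measurable_compose[OF this measurable_component_singleton[OF j]]
    show "(\<lambda>\<omega>. f (\<lambda>i\<in>I. (fst (yf \<omega> i), snd (yf \<omega> i), if i \<in> ?J then 1 else -1)) (fst (snd (sf \<omega>))) j)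
      \<in> borel_measurable \<Omega>" .
  next
    fix j assume "j \<in> I"
    from measurable_compose[OF u measurable_PiM_unif_component[OF this]]
    show "(\<lambda>\<omega>. snd (snd (snd (sf \<omega>))) j) \<in> borel_measurable \<Omega>" .
  qed
  have cl: "countable (I \<rightarrow>\<^sub>E {-1, 1::int})" "countable (I \<rightarrow>\<^sub>E (UNIV::bool set))" "countable {p. p permutes I}"
    by (auto intro!: countable_finite finite_PiE finite_permutations)
  show ?thesis
    unfolding excess_def case_prod_unfold
    by (rule measurable_compose_countable'[OF _ l cl(1)],
        rule measurable_compose_countable'[OF _ t cl(2)],
        rule measurable_compose_countable'[OF _ p cl(3)], rule fixed)
qed

text \<open>\<open>q\<close> stands for the conditional law of the labels given the data. The coins
  become a finite sum inside the integral, which leaves for each \<open>z\<close> and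
  \<open>p\<close> the integral over the uniforms bounded in
  \<open>nn_integral_labels_coins_le\<close>.\<close>

lemma nn_integral_seed_excess_le:
  assumes y: "y \<in> space SY"
    and q_nonneg: "\<And>i y. i \<in> I \<Longrightarrow> 0 \<le> q i y"
    and q_sum: "\<And>i. i \<in> I \<Longrightarrow> q i (-1) + q i 1 = (1::real)"
    and q_null: "\<And>i. i \<in> N \<Longrightarrow> q i 1 \<le> c0"
    and q_nonnull: "\<And>i y. i \<in> I - N \<Longrightarrow> y \<noteq> l0 i \<Longrightarrow> q i y = 0"
  shows "(\<integral>\<^sup>+\<sigma>. (\<Sum>l\<in>I \<rightarrow>\<^sub>E {-1, 1}. ennreal ((\<Prod>i\<in>I. q i (l i)) * of_bool (excess l y \<sigma>))) \<partial>seed_law m s MZ)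
    \<le> ennreal \<gamma>"
proof -
  define H where "H t r = (\<Sum>l\<in>I \<rightarrow>\<^sub>E {-1, 1}. ennreal ((\<Prod>i\<in>I. q i (l i)) * of_bool (excess l y (t, r))))" for t r
  have m0: "(\<lambda>\<sigma>. \<Sum>l\<in>I \<rightarrow>\<^sub>E {-1, 1}. ennreal ((\<Prod>i\<in>I. q i (l i)) * of_bool (excess l y \<sigma>)))
    \<in> borel_measurable (seed_law m s MZ)"
  proof (rule borel_measurable_sum)
    fix l assume "l \<in> I \<rightarrow>\<^sub>E {-1, 1::int}"
    then have [measurable]: "Measurable.pred (seed_law m s MZ) (excess l y)"
      using y pred_excess[of "\<lambda>_. l" "seed_law m s MZ" "\<lambda>_. y" "\<lambda>\<sigma>. \<sigma>"] by simp
    show "(\<lambda>\<sigma>. ennreal ((\<Prod>i\<in>I. q i (l i)) * of_bool (excess l y \<sigma>))) \<in> borel_measurable (seed_law m s MZ)"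
      by measurable
  qed
  interpret MZ: prob_space MZ by (rule MZ)
  interpret UU: prob_space unifs by (intro prob_space_PiM prob_space_unif)
  have fperm: "finite {p. p permutes I}" by (intro finite_permutations) simp
  interpret PP: prob_space perms
    using permutes_id[of I] by (intro prob_space_uniform_count_measure fperm) blast
  interpret PU: pair_prob_space perms unifs by unfold_locales
  interpret ZPU: pair_prob_space MZ "perms \<Otimes>\<^sub>M unifs" by unfold_locales
  let ?R = "MZ \<Otimes>\<^sub>M (perms \<Otimes>\<^sub>M unifs)"
  have H_eq: "H t r = (\<lambda>\<sigma>. \<Sum>l\<in>I \<rightarrow>\<^sub>E {-1, 1}. ennreal ((\<Prod>i\<in>I. q i (l i)) * of_bool (excess l y \<sigma>))) (t, r)" for t r
    by (simp add: H_def)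
  have Hm: "(\<lambda>r. H t r) \<in> borel_measurable ?R" if "t \<in> I \<rightarrow>\<^sub>E UNIV" for t
    unfolding H_eq using that
    by (intro measurable_compose[OF _ m0]) (auto simp: seed_law_def space_PiM)
  have "(\<integral>\<^sup>+\<sigma>. (\<Sum>l\<in>I \<rightarrow>\<^sub>E {-1, 1}. ennreal ((\<Prod>i\<in>I. q i (l i)) * of_bool (excess l y \<sigma>))) \<partial>seed_law m s MZ)
    = (\<integral>\<^sup>+t. \<integral>\<^sup>+r. H t r \<partial>?R \<partial>coins)"
    using ZPU.nn_integral_fst[OF m0[unfolded seed_law_def]] by (simp add: seed_law_def H_eq)
  also have "\<dots> = (\<Sum>t\<in>I \<rightarrow>\<^sub>E UNIV. ennreal (\<Prod>i\<in>I. pmf (bernoulli_pmf s) (t i)) * (\<integral>\<^sup>+r. H t r \<partial>?R))"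
    by (rule nn_integral_PiM_bernoulli) simp
  also have "\<dots> = (\<integral>\<^sup>+r. (\<Sum>t\<in>I \<rightarrow>\<^sub>E UNIV. ennreal (\<Prod>i\<in>I. pmf (bernoulli_pmf s) (t i)) * H t r) \<partial>?R)"
    using Hm by (simp add: nn_integral_sum nn_integral_cmult)
  also have "\<dots> = (\<integral>\<^sup>+z. \<integral>\<^sup>+p. \<integral>\<^sup>+u. (\<Sum>t\<in>I \<rightarrow>\<^sub>E UNIV. ennreal (\<Prod>i\<in>I. pmf (bernoulli_pmf s) (t i)) * H t (z, p, u))
      \<partial>unifs \<partial>perms \<partial>MZ)"
  proof -
    define K where "K r = (\<Sum>t\<in>I \<rightarrow>\<^sub>E UNIV. ennreal (\<Prod>i\<in>I. pmf (bernoulli_pmf s) (t i)) * H t r)" for r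
    have K: "K \<in> borel_measurable ?R"
      unfolding K_def using Hm by (intro borel_measurable_sum borel_measurable_times) auto
    have "integral\<^sup>N ?R K = (\<integral>\<^sup>+z. \<integral>\<^sup>+r. K (z, r) \<partial>(perms \<Otimes>\<^sub>M unifs) \<partial>MZ)"
      by (rule PU.nn_integral_fst[OF K, symmetric])
    also have "\<dots> = (\<integral>\<^sup>+z. \<integral>\<^sup>+p. \<integral>\<^sup>+u. K (z, p, u) \<partial>unifs \<partial>perms \<partial>MZ)"
    proof (rule nn_integral_cong)
      fix z assume z: "z \<in> space MZ"
      have "(\<lambda>r. K (z, r)) \<in> borel_measurable (perms \<Otimes>\<^sub>M unifs)"
        by (rule measurable_compose[OF measurable_Pair1'[OF z] K])
      from UU.nn_integral_fst[OF this]
      show "(\<integral>\<^sup>+r. K (z, r) \<partial>(perms \<Otimes>\<^sub>M unifs)) = (\<integral>\<^sup>+p. \<integral>\<^sup>+u. K (z, p, u) \<partial>unifs \<partial>perms)"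
        by simp
    qed
    finally show ?thesis unfolding K_def .
  qed
  also have "\<dots> \<le> (\<integral>\<^sup>+z. \<integral>\<^sup>+p. ennreal \<gamma> \<partial>perms \<partial>MZ)"
  proof (intro nn_integral_mono)
    fix z p assume "p \<in> space perms"
    then have p: "inj_on p I"
      by (auto simp: space_uniform_count_measure intro: permutes_inj_on)
    define v where "v J = f (\<lambda>i\<in>I. (fst (y i), snd (y i), if i \<in> J then 1 else -1)) z" for J
    let ?b = "\<lambda>l t u. FDP N (fdp_sd (c0 / (1 - s * (1 - c0))) \<alpha> \<gamma> (pseudo_targets m l t) l (v (pseudo_targets m l t)) p u) > \<alpha>"
    have ex: "excess l y (t, z, p, u) \<longleftrightarrow> ?b l t u" for l t u
      by (simp add: excess_def reset_fdx_eq v_def)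
    have "(\<Sum>t\<in>I \<rightarrow>\<^sub>E UNIV. ennreal (\<Prod>i\<in>I. pmf (bernoulli_pmf s) (t i)) * H t (z, p, u))
      = ennreal (\<Sum>l\<in>I \<rightarrow>\<^sub>E {-1, 1}. \<Sum>t\<in>I \<rightarrow>\<^sub>E UNIV.
      (\<Prod>i\<in>I. q i (l i)) * (\<Prod>i\<in>I. pmf (bernoulli_pmf s) (t i)) * of_bool (?b l t u))" for u
    proof -
      have nn: "0 \<le> (\<Prod>i\<in>I. q i (l i))" for l
        using q_nonneg by (intro prod_nonneg) auto
      have nn': "0 \<le> (\<Prod>i\<in>I. pmf (bernoulli_pmf s) (t i))" for t
        by (intro prod_nonneg) auto
      have "(\<Sum>t\<in>I \<rightarrow>\<^sub>E UNIV. ennreal (\<Prod>i\<in>I. pmf (bernoulli_pmf s) (t i)) * H t (z, p, u))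
        = (\<Sum>t\<in>I \<rightarrow>\<^sub>E UNIV. ennreal (\<Sum>l\<in>I \<rightarrow>\<^sub>E {-1, 1}. (\<Prod>i\<in>I. q i (l i)) *
          (\<Prod>i\<in>I. pmf (bernoulli_pmf s) (t i)) * of_bool (?b l t u)))"
      proof (rule sum.cong[OF refl])
        fix t :: "nat \<Rightarrow> bool"
        have "ennreal (\<Prod>i\<in>I. pmf (bernoulli_pmf s) (t i)) * H t (z, p, u)
          = ennreal ((\<Prod>i\<in>I. pmf (bernoulli_pmf s) (t i)) * (\<Sum>l\<in>I \<rightarrow>\<^sub>E {-1, 1}. (\<Prod>i\<in>I. q i (l i)) * of_bool (?b l t u)))"
          unfolding H_def ex using nn nn' by (subst sum_ennreal) (auto simp: ennreal_mult sum_nonneg)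
        then show "ennreal (\<Prod>i\<in>I. pmf (bernoulli_pmf s) (t i)) * H t (z, p, u)
          = ennreal (\<Sum>l\<in>I \<rightarrow>\<^sub>E {-1, 1}. (\<Prod>i\<in>I. q i (l i)) * (\<Prod>i\<in>I. pmf (bernoulli_pmf s) (t i)) * of_bool (?b l t u))"
          by (simp only: sum_distrib_left mult_ac)
      qed
      also have "\<dots> = ennreal (\<Sum>t\<in>I \<rightarrow>\<^sub>E UNIV. \<Sum>l\<in>I \<rightarrow>\<^sub>E {-1, 1}. (\<Prod>i\<in>I. q i (l i)) *
          (\<Prod>i\<in>I. pmf (bernoulli_pmf s) (t i)) * of_bool (?b l t u))"
        using nn nn' by (intro sum_ennreal sum_nonneg mult_nonneg_nonneg) auto
      finally show ?thesis by (subst sum.swap)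
    qed
    moreover have "(\<integral>\<^sup>+u. ennreal (\<Sum>l\<in>I \<rightarrow>\<^sub>E {-1, 1}. \<Sum>t\<in>I \<rightarrow>\<^sub>E UNIV.
      (\<Prod>i\<in>I. q i (l i)) * (\<Prod>i\<in>I. pmf (bernoulli_pmf s) (t i)) * of_bool (?b l t u)) \<partial>unifs) \<le> ennreal \<gamma>"
      by (rule nn_integral_labels_coins_le[OF s c0 alpha gamma p, where q = q and ?l0.0 = l0 and v = v])
        (fact q_nonneg q_sum q_null q_nonnull)+
    ultimately show "(\<integral>\<^sup>+u. (\<Sum>t\<in>I \<rightarrow>\<^sub>E UNIV. ennreal (\<Prod>i\<in>I. pmf (bernoulli_pmf s) (t i)) * H t (z, p, u)) \<partial>unifs)
      \<le> ennreal \<gamma>"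
      by (simp only:)
  qed
  also have "\<dots> = ennreal \<gamma>"
    by (simp only: nn_integral_const PP.emeasure_space_1 MZ.emeasure_space_1 mult.right_neutral)
  finally show ?thesis .
qed

end

section \<open>Conditioning on the nonnull algebra\<close>

text \<open>As \<Phi> is measurable for \<open>F\<close>, the indicator of the label event may be
  replaced by its conditional expectation, which conditional independence turns into a
  product.\<close>

lemma nn_integral_cond_indep_labels:
  fixes \<Phi> :: "'w \<Rightarrow> real"
  assumes M: "prob_space M" and sub: "subalgebra M F" and N: "finite N"
    and ci: "cond_indep_vars M F (\<lambda>_. label_space) L N"
    and \<Phi>: "\<Phi> \<in> borel_measurable F" "\<And>\<omega>. 0 \<le> \<Phi> \<omega>" "\<And>\<omega>. \<Phi> \<omega> \<le> 1"
    and l: "\<And>i. i \<in> N \<Longrightarrow> l i \<in> {-1, 1}"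
  defines "g \<equiv> \<lambda>i. cond_prob_alg M F {\<omega> \<in> space M. L i \<omega> = 1}"
  shows "(\<integral>\<^sup>+\<omega>. ennreal (\<Phi> \<omega> * of_bool (\<forall>i\<in>N. L i \<omega> = l i)) \<partial>M)
    = (\<integral>\<^sup>+\<omega>. ennreal (\<Phi> \<omega> * (\<Prod>i\<in>N. if l i = 1 then g i \<omega> else 1 - g i \<omega>)) \<partial>M)"
\<comment> \<open>The empty case is apart: \<open>cond_indep_vars\<close> speaks of nonempty index
  sets only, and the empty intersection is the universe instead of \<open>space M\<close>.\<close>
proof (cases "N = {}")
  case False
  interpret prob_space M by (rule M)
  interpret finite_measure_subalgebra M F
    by unfold_locales (rule sub)
  have L: "L i \<in> measurable M label_space" if "i \<in> N" for i
    using ci that by (simp add: cond_indep_vars_def)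
  have Lv: "L i \<omega> \<in> {-1, 1}" if "i \<in> N" "\<omega> \<in> space M" for i \<omega>
    using measurable_space[OF L[OF that(1)] that(2)] by simp
  have ev: "L i -` {y} \<inter> space M \<in> sets M" if "i \<in> N" "y \<in> {-1, 1}" for i y
    using measurable_sets[OF L[OF that(1)], of "{y}"] that by simp
  define A where "A = (\<Inter>i\<in>N. L i -` {l i} \<inter> space M)"
  have A: "A \<in> sets M" unfolding A_def using N False ev l by (intro sets.finite_INT) auto
  have \<Phi>M: "\<Phi> \<in> borel_measurable M" using measurable_from_subalg[OF sub \<Phi>(1)] .
  have one: "AE \<omega> in M. cond_prob_alg M F (L i -` {l i} \<inter> space M) \<omega> = (if l i = 1 then g i \<omega> else 1 - g i \<omega>)"
    if i: "i \<in> N" for i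
  proof -
    have e1: "{\<omega> \<in> space M. L i \<omega> = 1} = L i -` {1} \<inter> space M" by auto
    show ?thesis
    proof (cases "l i = 1")
      case True
      then show ?thesis by (simp add: g_def e1)
    next
      case False
      then have li: "l i = -1" using l[OF i] by auto
      have int: "integrable M (indicator (L i -` {1} \<inter> space M) :: _ \<Rightarrow> real)"
        using ev[OF i, of 1] by (intro integrable_real_indicator) (auto simp: emeasure_eq_measure)
      \<comment> \<open>Labels take two values on \<open>space M\<close>, so linearity gives the
        conditional probability of \<open>-1\<close> as one minus that of \<open>1\<close>.\<close>
      have "AE \<omega> in M. real_cond_exp M F (\<lambda>\<omega>. 1 - indicator (L i -` {1} \<inter> space M) \<omega>) \<omega>
        = real_cond_exp M F (\<lambda>\<omega>. 1) \<omega> - real_cond_exp M F (indicator (L i -` {1} \<inter> space M)) \<omega>"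
        by (rule real_cond_exp_diff) (use int in auto)
      moreover have "AE \<omega> in M. real_cond_exp M F (\<lambda>\<omega>. 1) \<omega> = 1"
        by (rule real_cond_exp_F_meas) auto
      moreover have "AE \<omega> in M. real_cond_exp M F (\<lambda>\<omega>. 1 - indicator (L i -` {1} \<inter> space M) \<omega>) \<omega>
        = real_cond_exp M F (indicator (L i -` {-1} \<inter> space M)) \<omega>"
      proof (rule real_cond_exp_cong)
        show "AE \<omega> in M. 1 - indicator (L i -` {1} \<inter> space M) \<omega> = (indicator (L i -` {-1} \<inter> space M) \<omega> :: real)"
          using Lv[OF i] by (intro AE_I2) (auto simp: indicator_def)
      qed (use ev[OF i, of 1] ev[OF i, of "-1"] in auto)
      ultimately show ?thesis
        unfolding g_def e1 cond_prob_alg_def li by eventually_elim simp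
    qed
  qed
  have prod: "AE \<omega> in M. cond_prob_alg M F A \<omega> = (\<Prod>i\<in>N. if l i = 1 then g i \<omega> else 1 - g i \<omega>)"
  proof -
    have "AE \<omega> in M. cond_prob_alg M F A \<omega> = (\<Prod>i\<in>N. cond_prob_alg M F (L i -` {l i} \<inter> space M) \<omega>)"
      unfolding A_def using ci N False l unfolding cond_indep_vars_def
      by (elim conjE allE[of _ N] impE ballE[of _ _ "\<lambda>i. {l i}"]) auto
    moreover have "AE \<omega> in M. \<forall>i\<in>N. cond_prob_alg M F (L i -` {l i} \<inter> space M) \<omega> = (if l i = 1 then g i \<omega> else 1 - g i \<omega>)"
      using N one by (intro AE_finite_allI) auto
    ultimately show ?thesis by eventually_elim (simp cong: prod.cong)
  qed
  have int: "integrable M (\<lambda>\<omega>. \<Phi> \<omega> * indicator A \<omega>)"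
  proof (rule integrable_const_bound[of _ 1])
    show "AE \<omega> in M. norm (\<Phi> \<omega> * indicator A \<omega>) \<le> 1"
      using \<Phi> by (intro AE_I2) (auto simp: indicator_def)
    show "(\<lambda>\<omega>. \<Phi> \<omega> * indicator A \<omega>) \<in> borel_measurable M" using \<Phi>M A by measurable
  qed
  note ce = real_cond_exp_intg[OF int \<Phi>(1)]
  have Am: "(indicator A :: _ \<Rightarrow> real) \<in> borel_measurable M" using A by measurable
  have pos: "AE \<omega> in M. 0 \<le> real_cond_exp M F (indicator A) \<omega>"
    by (rule real_cond_exp_pos) (use Am in auto)
  have "(\<integral>\<^sup>+\<omega>. ennreal (\<Phi> \<omega> * of_bool (\<forall>i\<in>N. L i \<omega> = l i)) \<partial>M) = (\<integral>\<^sup>+\<omega>. ennreal (\<Phi> \<omega> * indicator A \<omega>) \<partial>M)"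
    using False by (intro nn_integral_cong) (auto simp: A_def indicator_def)
  also have "\<dots> = ennreal (\<integral>\<omega>. \<Phi> \<omega> * indicator A \<omega> \<partial>M)"
    using int \<Phi> by (intro nn_integral_eq_integral) auto
  also have "(\<integral>\<omega>. \<Phi> \<omega> * indicator A \<omega> \<partial>M) = (\<integral>\<omega>. \<Phi> \<omega> * real_cond_exp M F (indicator A) \<omega> \<partial>M)"
    using ce(2)[OF Am] by simp
  also have "ennreal \<dots> = (\<integral>\<^sup>+\<omega>. ennreal (\<Phi> \<omega> * real_cond_exp M F (indicator A) \<omega>) \<partial>M)"
    using ce(1)[OF Am] pos \<Phi> by (intro nn_integral_eq_integral[symmetric]) auto
  also have "\<dots> = (\<integral>\<^sup>+\<omega>. ennreal (\<Phi> \<omega> * (\<Prod>i\<in>N. if l i = 1 then g i \<omega> else 1 - g i \<omega>)) \<partial>M)"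
    using prod unfolding cond_prob_alg_def by (intro nn_integral_cong_AE) auto
  finally show ?thesis .
qed simp

theorem theorem2:
  fixes M :: "'w measure" and MX :: "'x measure" and MZ :: "'z measure"
    and m :: nat and N :: "nat set"
    and \<alpha> \<gamma> s c0 :: real
    and L :: "nat \<Rightarrow> 'w \<Rightarrow> int" and W :: "nat \<Rightarrow> 'w \<Rightarrow> real" and x :: "nat \<Rightarrow> 'w \<Rightarrow> 'x"
    and f :: "(nat \<Rightarrow> real \<times> 'x \<times> int) \<Rightarrow> 'z \<Rightarrow> nat \<Rightarrow> real"
    and T :: "nat \<Rightarrow> 'w \<Rightarrow> bool" and Z :: "'w \<Rightarrow> 'z"
    and P :: "'w \<Rightarrow> nat \<Rightarrow> nat" and U :: "nat \<Rightarrow> 'w \<Rightarrow> real"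
  assumes M: "prob_space M" and MZ: "prob_space MZ"
    and alpha: "0 < \<alpha>" "\<alpha> < 1" and gamma: "0 < \<gamma>" "\<gamma> < 1"
    and s: "0 \<le> s" "s < 1" and c0: "0 < c0" "c0 < 1"
    and N: "N \<subseteq> {1..m}"
    and L: "\<And>i. i \<in> {1..m} \<Longrightarrow> L i \<in> measurable M label_space"
    and W: "\<And>i. i \<in> {1..m} \<Longrightarrow> W i \<in> borel_measurable M"
    and x: "\<And>i. i \<in> {1..m} \<Longrightarrow> x i \<in> measurable M MX"
    and null_indep:
      "cond_indep_vars M (nonnull_algebra M m MX N L W x) (\<lambda>_. label_space) L N"
    and null_prob:
      "\<And>i. i \<in> N \<Longrightarrow>
         AE \<omega> in M. cond_prob_alg M (nonnull_algebra M m MX N L W x)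
                      {\<omega> \<in> space M. L i \<omega> = 1} \<omega> \<le> c0"
    and f: "(\<lambda>(y, z). f y z) \<in>
         measurable ((\<Pi>\<^sub>M i\<in>{1..m}. borel \<Otimes>\<^sub>M (MX \<Otimes>\<^sub>M label_space)) \<Otimes>\<^sub>M MZ)
                    (\<Pi>\<^sub>M i\<in>{1..m}. borel)"
    and seed_meas: "seed_vec m T Z P U \<in> measurable M (seed_law m s MZ)"
    and seed_indep:
      "prob_space.indep_set M
         (sets (vimage_algebra (space M) (data_vec m L W x) (data_space m MX)))
         (sets (vimage_algebra (space M) (seed_vec m T Z P U) (seed_law m s MZ)))"
    and seed_distr:
      "distr M (seed_law m s MZ) (seed_vec m T Z P U) = seed_law m s MZ"
  shows "measure M {\<omega> \<in> space M.
           FDP N (reset_fdx m \<alpha> \<gamma> s c0 f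
                    (\<lambda>i. L i \<omega>) (\<lambda>i. W i \<omega>) (\<lambda>i. x i \<omega>)
                    (\<lambda>i. T i \<omega>) (Z \<omega>) (P \<omega>) (\<lambda>i. U i \<omega>)) > \<alpha>} \<le> \<gamma>"
proof -
  interpret M: prob_space M by (rule M)
  interpret RM: reset_model MX MZ m N \<alpha> \<gamma> s c0 f
    by (rule reset_model.intro) (fact MZ alpha gamma s c0 N f)+
  let ?I = "{1..m}"
  let ?SL = "\<Pi>\<^sub>M i\<in>?I. label_space"
  let ?SY = "\<Pi>\<^sub>M i\<in>?I. (borel :: real measure) \<Otimes>\<^sub>M MX"
  let ?S = "seed_law m s MZ"
  let ?F = "nonnull_algebra M m MX N L W x"
  define Lv where "Lv \<omega> = (\<lambda>i\<in>?I. L i \<omega>)" for \<omega>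
  define Y where "Y \<omega> = (\<lambda>i\<in>?I. (W i \<omega>, x i \<omega>))" for \<omega>
  define S where "S = seed_vec m T Z P U"
  define h where "h \<omega> = (\<lambda>i\<in>?I - N. L i \<omega>, Y \<omega>)" for \<omega>
  have fN: "finite N" using N by (rule finite_subset) simp
  have Lv: "Lv \<in> measurable M ?SL" unfolding Lv_def by (intro measurable_restrict L)
  have Y: "Y \<in> measurable M ?SY" unfolding Y_def by (intro measurable_restrict measurable_Pair W x)
  have h: "h \<in> measurable M ((\<Pi>\<^sub>M i\<in>?I - N. label_space) \<Otimes>\<^sub>M ?SY)"
    unfolding h_def using L by (intro measurable_Pair measurable_restrict Y) auto
  have F: "?F = vimage_algebra (space M) h ((\<Pi>\<^sub>M i\<in>?I - N. label_space) \<Otimes>\<^sub>M ?SY)"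
    by (simp add: nonnull_algebra_def h_def[abs_def] Y_def)
  have sub: "subalgebra M ?F"
    unfolding subalgebra_def F using measurable_iff_sets[THEN iffD1, OF h] by simp
  have hF: "h \<in> measurable ?F ((\<Pi>\<^sub>M i\<in>?I - N. label_space) \<Otimes>\<^sub>M ?SY)"
    unfolding F using measurable_space[OF h] by (intro measurable_vimage_algebra1) auto
  interpret FS: finite_measure_subalgebra M ?F by unfold_locales (rule sub)
  interpret S: prob_space ?S
    using M.prob_space_distr[OF seed_meas] unfolding seed_distr .
  interpret MS: pair_prob_space M ?S by unfold_locales
  define g where "g i = cond_prob_alg M ?F {\<omega> \<in> space M. L i \<omega> = 1}" for i
  have g_meas: "g i \<in> borel_measurable M" for i
    unfolding g_def cond_prob_alg_def by simp
  \<comment> \<open>The conditional law of label \<open>i\<close> given the nonnull algebra: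
    determined by \<open>g\<close> for a null, a point mass at the observed label otherwise.\<close>
  define q where "q \<omega> i y = (if i \<in> N then (if y = 1 then g i \<omega> else 1 - g i \<omega>) else of_bool (y = L i \<omega>))"
    for \<omega> i and y :: int
  have g_range: "AE \<omega> in M. \<forall>i\<in>N. 0 \<le> g i \<omega> \<and> g i \<omega> \<le> c0"
  proof (intro AE_finite_allI[OF fN])
    fix i assume i: "i \<in> N"
    then have "L i -` {1} \<inter> space M \<in> sets M"
      using L[of i] N by (intro measurable_sets[OF L]) auto
    also have "L i -` {1} \<inter> space M = {\<omega> \<in> space M. L i \<omega> = 1}" by auto
    finally have "AE \<omega> in M. 0 \<le> g i \<omega>"
      unfolding g_def cond_prob_alg_def by (intro FS.real_cond_exp_pos) auto
    moreover have "AE \<omega> in M. g i \<omega> \<le> c0"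
      unfolding g_def by (rule null_prob[OF i])
    ultimately show "AE \<omega> in M. 0 \<le> g i \<omega> \<and> g i \<omega> \<le> c0" by eventually_elim simp
  qed
  have L_val: "L i \<omega> = -1 \<or> L i \<omega> = 1" if "i \<in> ?I" "\<omega> \<in> space M" for i \<omega>
    using measurable_space[OF L[OF that(1)] that(2)] by auto
  have q_meas: "(\<lambda>\<omega>. q \<omega> i y) \<in> borel_measurable M" if "i \<in> ?I" for i y
  proof (cases "i \<in> N")
    case True
    then show ?thesis using g_meas[of i] by (cases "y = 1") (simp_all add: q_def)
  next
    case False
    have "(\<lambda>\<omega>. of_bool (y = L i \<omega>) :: real) \<in> borel_measurable M"
      by (rule measurable_compose[OF L[OF that]]) simp
    then show ?thesis using False by (simp add: q_def)
  qed

  \<comment> \<open>Joint law of data and seed\<close>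
  have dv: "data_vec m L W x = (\<lambda>\<omega>. (Lv \<omega>, Y \<omega>))"
    by (simp add: data_vec_def[abs_def] Lv_def Y_def)
  have LY: "(\<lambda>\<omega>. (Lv \<omega>, Y \<omega>)) \<in> measurable M (?SL \<Otimes>\<^sub>M ?SY)" by (intro measurable_Pair Lv Y)
  have Sm: "S \<in> measurable M ?S" using seed_meas by (simp add: S_def)
  define D where "D = distr M (?SL \<Otimes>\<^sub>M ?SY) (\<lambda>\<omega>. (Lv \<omega>, Y \<omega>))"
  interpret D: prob_space D unfolding D_def by (rule M.prob_space_distr[OF LY])
  \<comment> \<open>Independence is assumed for the generated sigma-algebras; on rectangles it
    yields the product law to which Fubini applies.\<close>
  have joint: "D \<Otimes>\<^sub>M ?S = distr M ((?SL \<Otimes>\<^sub>M ?SY) \<Otimes>\<^sub>M ?S) (\<lambda>\<omega>. ((Lv \<omega>, Y \<omega>), S \<omega>))"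
  proof (rule pair_measure_eqI)
    show "sets (D \<Otimes>\<^sub>M ?S) = sets (distr M ((?SL \<Otimes>\<^sub>M ?SY) \<Otimes>\<^sub>M ?S) (\<lambda>\<omega>. ((Lv \<omega>, Y \<omega>), S \<omega>)))"
      unfolding sets_distr by (intro sets_pair_measure_cong) (simp_all add: D_def)
    fix A B assume AD: "A \<in> sets D" and B: "B \<in> sets ?S"
    have A: "A \<in> sets (?SL \<Otimes>\<^sub>M ?SY)" using AD by (simp add: D_def)
    let ?A = "(\<lambda>\<omega>. (Lv \<omega>, Y \<omega>)) -` A \<inter> space M" and ?B = "S -` B \<inter> space M"
    have "?A \<in> sets (vimage_algebra (space M) (data_vec m L W x) (data_space m MX))"
      unfolding dv data_space_def by (rule in_vimage_algebra[OF A])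
    moreover have "?B \<in> sets (vimage_algebra (space M) (seed_vec m T Z P U) ?S)"
      unfolding S_def by (rule in_vimage_algebra[OF B])
    ultimately have "M.prob (?A \<inter> ?B) = M.prob ?A * M.prob ?B"
      by (rule M.indep_setD[OF seed_indep])
    moreover have "emeasure D A = ennreal (M.prob ?A)"
      unfolding D_def emeasure_distr[OF LY A] by (simp only: M.emeasure_eq_measure)
    moreover have "emeasure ?S B = ennreal (M.prob ?B)"
      using emeasure_distr[OF Sm B] seed_distr by (simp add: S_def M.emeasure_eq_measure)
    moreover have "emeasure (distr M ((?SL \<Otimes>\<^sub>M ?SY) \<Otimes>\<^sub>M ?S) (\<lambda>\<omega>. ((Lv \<omega>, Y \<omega>), S \<omega>))) (A \<times> B)
      = ennreal (M.prob (?A \<inter> ?B))"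
      unfolding emeasure_distr[OF measurable_Pair[OF LY Sm] pair_measureI[OF A B]]
      by (auto simp: M.emeasure_eq_measure intro!: arg_cong[where f = M.prob])
    ultimately show "emeasure D A * emeasure ?S B
      = emeasure (distr M ((?SL \<Otimes>\<^sub>M ?SY) \<Otimes>\<^sub>M ?S) (\<lambda>\<omega>. ((Lv \<omega>, Y \<omega>), S \<omega>))) (A \<times> B)"
      by (simp add: ennreal_mult)
  qed (unfold_locales)

  \<comment> \<open>The error probability as an iterated integral\<close>
  let ?ex = "RM.excess"
  have ex_pred: "Measurable.pred ((?SL \<Otimes>\<^sub>M ?SY) \<Otimes>\<^sub>M ?S) (\<lambda>\<omega>. ?ex (fst (fst \<omega>)) (snd (fst \<omega>)) (snd \<omega>))"
    by (rule RM.pred_excess)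
      (auto intro!: measurable_compose[OF measurable_compose[OF measurable_fst measurable_fst] measurable_PiM_label_space])
  have event: "FDP N (reset_fdx m \<alpha> \<gamma> s c0 f (\<lambda>i. L i \<omega>) (\<lambda>i. W i \<omega>) (\<lambda>i. x i \<omega>)
      (\<lambda>i. T i \<omega>) (Z \<omega>) (P \<omega>) (\<lambda>i. U i \<omega>)) > \<alpha> \<longleftrightarrow> ?ex (Lv \<omega>) (Y \<omega>) (S \<omega>)" for \<omega>
    unfolding RM.excess_def S_def seed_vec_def prod.case
    by (subst reset_fdx_cong[of m "\<lambda>i. L i \<omega>" "Lv \<omega>" "\<lambda>i. W i \<omega>" "\<lambda>i. fst (Y \<omega> i)" "\<lambda>i. x i \<omega>" "\<lambda>i. snd (Y \<omega> i)"
        "\<lambda>i. T i \<omega>" "\<lambda>i\<in>?I. T i \<omega>" "\<lambda>i. U i \<omega>" "\<lambda>i\<in>?I. U i \<omega>"])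
      (auto simp: Lv_def Y_def)
  define ind where "ind a \<sigma> = (of_bool (?ex (fst a) (snd a) \<sigma>) :: ennreal)" for a \<sigma>
  have ind_meas: "case_prod ind \<in> borel_measurable ((?SL \<Otimes>\<^sub>M ?SY) \<Otimes>\<^sub>M ?S)"
    using ex_pred unfolding ind_def case_prod_unfold by measurable
  have "emeasure M {\<omega> \<in> space M. ?ex (Lv \<omega>) (Y \<omega>) (S \<omega>)} = (\<integral>\<^sup>+\<omega>. ind (Lv \<omega>, Y \<omega>) (S \<omega>) \<partial>M)"
  proof -
    have "{\<omega> \<in> space M. ?ex (Lv \<omega>) (Y \<omega>) (S \<omega>)} \<in> sets M"
      using measurable_compose[OF measurable_Pair[OF LY Sm] ex_pred] by (simp add: pred_def)
    then have "emeasure M {\<omega> \<in> space M. ?ex (Lv \<omega>) (Y \<omega>) (S \<omega>)}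
      = (\<integral>\<^sup>+\<omega>. indicator {\<omega> \<in> space M. ?ex (Lv \<omega>) (Y \<omega>) (S \<omega>)} \<omega> \<partial>M)" by simp
    also have "\<dots> = (\<integral>\<^sup>+\<omega>. ind (Lv \<omega>, Y \<omega>) (S \<omega>) \<partial>M)"
      by (intro nn_integral_cong) (auto simp: ind_def indicator_def)
    finally show ?thesis .
  qed
  also have "\<dots> = integral\<^sup>N (D \<Otimes>\<^sub>M ?S) (case_prod ind)"
    unfolding joint
    by (subst nn_integral_distr[OF measurable_Pair[OF LY Sm]]) (use ind_meas in auto)
  also have "\<dots> = (\<integral>\<^sup>+a. \<integral>\<^sup>+\<sigma>. ind a \<sigma> \<partial>?S \<partial>D)"
    by (subst S.nn_integral_fst[symmetric]) (use ind_meas in \<open>simp_all add: D_def cong: measurable_cong_sets\<close>)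
  also have "\<dots> = (\<integral>\<^sup>+\<omega>. \<integral>\<^sup>+\<sigma>. ind (Lv \<omega>, Y \<omega>) \<sigma> \<partial>?S \<partial>M)"
    unfolding D_def using S.borel_measurable_nn_integral[OF ind_meas]
    by (subst nn_integral_distr[OF LY]) auto
  \<comment> \<open>Conditional independence acts on \<omega> at a fixed seed, hence the exchange;
    it is undone later to bound the seed integral for each \<omega>.\<close>
  also have "\<dots> = (\<integral>\<^sup>+\<sigma>. \<integral>\<^sup>+\<omega>. ind (Lv \<omega>, Y \<omega>) \<sigma> \<partial>M \<partial>?S)"
  proof (rule MS.Fubini'[symmetric])
    show "(\<lambda>(\<omega>, \<sigma>). ind (Lv \<omega>, Y \<omega>) \<sigma>) \<in> borel_measurable (M \<Otimes>\<^sub>M ?S)"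
      using measurable_compose[OF measurable_Pair[OF measurable_compose[OF measurable_fst LY] measurable_snd] ind_meas]
      by (simp add: case_prod_unfold)
  qed
  also have "\<dots> = (\<integral>\<^sup>+\<sigma>. \<integral>\<^sup>+\<omega>. (\<Sum>l\<in>?I \<rightarrow>\<^sub>E {-1, 1}. ennreal ((\<Prod>i\<in>?I. q \<omega> i (l i)) * of_bool (?ex l (Y \<omega>) \<sigma>))) \<partial>M \<partial>?S)"
  proof (rule nn_integral_cong)
    fix \<sigma> assume \<sigma>: "\<sigma> \<in> space ?S"
    \<comment> \<open>The factor that is measurable for the nonnull algebra: once \<open>l\<close>
      is fixed, the error depends on \<omega> through \<open>Y\<close> only.\<close>
    define \<Phi> where "\<Phi> l \<omega> = (of_bool (\<forall>i\<in>?I - N. L i \<omega> = l i) * of_bool (?ex l (Y \<omega>) \<sigma>) :: real)" for l \<omega>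
    have \<Phi>_meas: "\<Phi> l \<in> borel_measurable ?F" if l: "l \<in> ?I \<rightarrow>\<^sub>E {-1, 1}" for l
    proof -
      let ?H = "(\<Pi>\<^sub>M i\<in>?I - N. label_space) \<Otimes>\<^sub>M ?SY"
      have [measurable]: "Measurable.pred ?H (\<lambda>a. \<forall>i\<in>?I - N. fst a i = l i)"
      proof (intro pred_intros_finite)
        fix i assume "i \<in> ?I - N"
        then have "(\<lambda>a. fst a i) \<in> measurable ?H label_space"
          by (rule measurable_compose[OF measurable_fst measurable_component_singleton])
        then show "Measurable.pred ?H (\<lambda>a. fst a i = l i)"
          by (rule measurable_compose) simp
      qed simp
      have [measurable]: "Measurable.pred ?H (\<lambda>a. ?ex l (snd a) \<sigma>)"
        using l \<sigma> by (intro RM.pred_excess) auto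
      have "(\<lambda>a. of_bool (\<forall>i\<in>?I - N. fst a i = l i) * of_bool (?ex l (snd a) \<sigma>) :: real) \<in> borel_measurable ?H"
        by measurable
      from measurable_compose[OF hF this] show ?thesis
        by (simp add: h_def \<Phi>_def[abs_def])
    qed
    \<comment> \<open>Splitting by the value \<open>l\<close> of the label vector makes the labels
      constants; only the term \<open>l = Lv \<omega>\<close> survives.\<close>
    have "(\<integral>\<^sup>+\<omega>. ind (Lv \<omega>, Y \<omega>) \<sigma> \<partial>M)
      = (\<integral>\<^sup>+\<omega>. (\<Sum>l\<in>?I \<rightarrow>\<^sub>E {-1, 1}. ennreal (\<Phi> l \<omega> * of_bool (\<forall>i\<in>N. L i \<omega> = l i))) \<partial>M)"
    proof (rule nn_integral_cong)
      fix \<omega> assume \<omega>: "\<omega> \<in> space M"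
      have Lv_PiE: "Lv \<omega> \<in> ?I \<rightarrow>\<^sub>E {-1, 1}" using L_val[OF _ \<omega>] by (auto simp: Lv_def)
      have eq: "\<Phi> l \<omega> * of_bool (\<forall>i\<in>N. L i \<omega> = l i) = of_bool (l = Lv \<omega>) * of_bool (?ex l (Y \<omega>) \<sigma>)"
        if l: "l \<in> ?I \<rightarrow>\<^sub>E {-1, 1}" for l
      proof -
        have "l = Lv \<omega> \<longleftrightarrow> (\<forall>i\<in>?I. L i \<omega> = l i)"
          using PiE_ext[OF l Lv_PiE] by (auto simp: Lv_def)
        also have "\<dots> \<longleftrightarrow> (\<forall>i\<in>?I - N. L i \<omega> = l i) \<and> (\<forall>i\<in>N. L i \<omega> = l i)"
          using N by blast
        finally show ?thesis by (simp add: \<Phi>_def)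
      qed
      have "(\<Sum>l\<in>?I \<rightarrow>\<^sub>E {-1, 1}. ennreal (\<Phi> l \<omega> * of_bool (\<forall>i\<in>N. L i \<omega> = l i)))
        = (\<Sum>l\<in>?I \<rightarrow>\<^sub>E {-1, 1}. ennreal (of_bool (l = Lv \<omega>) * of_bool (?ex l (Y \<omega>) \<sigma>)))"
        using eq by (intro sum.cong refl) simp
      also have "\<dots> = ind (Lv \<omega>, Y \<omega>) \<sigma>"
        using Lv_PiE by (subst sum.remove[of _ "Lv \<omega>"]) (auto simp: ind_def finite_PiE intro!: sum.neutral)
      finally show "ind (Lv \<omega>, Y \<omega>) \<sigma> = (\<Sum>l\<in>?I \<rightarrow>\<^sub>E {-1, 1}. ennreal (\<Phi> l \<omega> * of_bool (\<forall>i\<in>N. L i \<omega> = l i)))" ..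
    qed
    also have "\<dots> = (\<Sum>l\<in>?I \<rightarrow>\<^sub>E {-1, 1}. \<integral>\<^sup>+\<omega>. ennreal (\<Phi> l \<omega> * of_bool (\<forall>i\<in>N. L i \<omega> = l i)) \<partial>M)"
    proof (rule nn_integral_sum)
      fix l assume "l \<in> ?I \<rightarrow>\<^sub>E {-1, 1::int}"
      then have [measurable]: "\<Phi> l \<in> borel_measurable M"
        by (intro measurable_from_subalg[OF sub] \<Phi>_meas)
      have [measurable]: "Measurable.pred M (\<lambda>\<omega>. \<forall>i\<in>N. L i \<omega> = l i)"
      proof (intro pred_intros_finite fN)
        fix i assume "i \<in> N"
        then have "i \<in> ?I" using N by auto
        from measurable_compose[OF L[OF this], of "\<lambda>y. y = l i"]
        show "Measurable.pred M (\<lambda>\<omega>. L i \<omega> = l i)" by simp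
      qed
      show "(\<lambda>\<omega>. ennreal (\<Phi> l \<omega> * of_bool (\<forall>i\<in>N. L i \<omega> = l i))) \<in> borel_measurable M"
        by measurable
    qed
    also have "\<dots> = (\<Sum>l\<in>?I \<rightarrow>\<^sub>E {-1, 1}. \<integral>\<^sup>+\<omega>. ennreal ((\<Prod>i\<in>?I. q \<omega> i (l i)) * of_bool (?ex l (Y \<omega>) \<sigma>)) \<partial>M)"
    proof (rule sum.cong[OF refl])
      fix l assume l: "l \<in> ?I \<rightarrow>\<^sub>E {-1, 1::int}"
      have "(\<integral>\<^sup>+\<omega>. ennreal (\<Phi> l \<omega> * of_bool (\<forall>i\<in>N. L i \<omega> = l i)) \<partial>M)
        = (\<integral>\<^sup>+\<omega>. ennreal (\<Phi> l \<omega> * (\<Prod>i\<in>N. if l i = 1 then g i \<omega> else 1 - g i \<omega>)) \<partial>M)"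
        unfolding g_def
      proof (rule nn_integral_cond_indep_labels[OF M sub fN null_indep \<Phi>_meas[OF l]])
        show "l i \<in> {-1, 1}" if "i \<in> N" for i using l N that by (auto simp: PiE_iff)
      qed (simp_all add: \<Phi>_def)
      also have "\<dots> = (\<integral>\<^sup>+\<omega>. ennreal ((\<Prod>i\<in>?I. q \<omega> i (l i)) * of_bool (?ex l (Y \<omega>) \<sigma>)) \<partial>M)"
      proof (intro nn_integral_cong arg_cong[where f = ennreal])
        fix \<omega>
        have "(\<Prod>i\<in>?I. q \<omega> i (l i)) = (\<Prod>i\<in>?I - N. q \<omega> i (l i)) * (\<Prod>i\<in>N. q \<omega> i (l i))"
          by (rule prod.subset_diff[OF N]) simp
        also have "(\<Prod>i\<in>N. q \<omega> i (l i)) = (\<Prod>i\<in>N. if l i = 1 then g i \<omega> else 1 - g i \<omega>)"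
          by (intro prod.cong) (auto simp: q_def)
        also have "(\<Prod>i\<in>?I - N. q \<omega> i (l i)) = (\<Prod>i\<in>?I - N. of_bool (L i \<omega> = l i) * 1)"
          by (intro prod.cong) (auto simp: q_def)
        also have "\<dots> = of_bool (\<forall>i\<in>?I - N. L i \<omega> = l i)"
          by (subst prod_of_bool) simp_all
        finally show "\<Phi> l \<omega> * (\<Prod>i\<in>N. if l i = 1 then g i \<omega> else 1 - g i \<omega>)
          = (\<Prod>i\<in>?I. q \<omega> i (l i)) * of_bool (?ex l (Y \<omega>) \<sigma>)"
          by (simp only: \<Phi>_def mult_ac)
      qed
      finally show "(\<integral>\<^sup>+\<omega>. ennreal (\<Phi> l \<omega> * of_bool (\<forall>i\<in>N. L i \<omega> = l i)) \<partial>M)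
        = (\<integral>\<^sup>+\<omega>. ennreal ((\<Prod>i\<in>?I. q \<omega> i (l i)) * of_bool (?ex l (Y \<omega>) \<sigma>)) \<partial>M)" .
    qed
    also have "\<dots> = (\<integral>\<^sup>+\<omega>. (\<Sum>l\<in>?I \<rightarrow>\<^sub>E {-1, 1}. ennreal ((\<Prod>i\<in>?I. q \<omega> i (l i)) * of_bool (?ex l (Y \<omega>) \<sigma>))) \<partial>M)"
    proof (rule nn_integral_sum[symmetric])
      fix l assume l: "l \<in> ?I \<rightarrow>\<^sub>E {-1, 1::int}"
      have [measurable]: "Measurable.pred M (\<lambda>\<omega>. ?ex l (Y \<omega>) \<sigma>)"
        using l \<sigma> by (intro RM.pred_excess Y) auto
      have [measurable]: "(\<lambda>\<omega>. \<Prod>i\<in>?I. q \<omega> i (l i)) \<in> borel_measurable M"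
        by (intro borel_measurable_prod q_meas)
      show "(\<lambda>\<omega>. ennreal ((\<Prod>i\<in>?I. q \<omega> i (l i)) * of_bool (?ex l (Y \<omega>) \<sigma>))) \<in> borel_measurable M"
        by measurable
    qed
    finally show "(\<integral>\<^sup>+\<omega>. ind (Lv \<omega>, Y \<omega>) \<sigma> \<partial>M)
      = (\<integral>\<^sup>+\<omega>. (\<Sum>l\<in>?I \<rightarrow>\<^sub>E {-1, 1}. ennreal ((\<Prod>i\<in>?I. q \<omega> i (l i)) * of_bool (?ex l (Y \<omega>) \<sigma>))) \<partial>M)" .
  qed
  also have "\<dots> = (\<integral>\<^sup>+\<omega>. \<integral>\<^sup>+\<sigma>. (\<Sum>l\<in>?I \<rightarrow>\<^sub>E {-1, 1}. ennreal ((\<Prod>i\<in>?I. q \<omega> i (l i)) * of_bool (?ex l (Y \<omega>) \<sigma>))) \<partial>?S \<partial>M)"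
  proof (rule MS.Fubini', unfold case_prod_unfold, rule borel_measurable_sum)
    fix l assume l: "l \<in> ?I \<rightarrow>\<^sub>E {-1, 1::int}"
    have [measurable]: "Measurable.pred (M \<Otimes>\<^sub>M ?S) (\<lambda>a. ?ex l (Y (fst a)) (snd a))"
      using l by (intro RM.pred_excess measurable_compose[OF measurable_fst Y]) auto
    have [measurable]: "(\<lambda>a. \<Prod>i\<in>?I. q (fst a) i (l i)) \<in> borel_measurable (M \<Otimes>\<^sub>M ?S)"
      by (intro borel_measurable_prod measurable_compose[OF measurable_fst q_meas])
    show "(\<lambda>a. ennreal ((\<Prod>i\<in>?I. q (fst a) i (l i)) * of_bool (?ex l (Y (fst a)) (snd a))))
      \<in> borel_measurable (M \<Otimes>\<^sub>M ?S)"
      by measurable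
  qed
  also have "\<dots> \<le> (\<integral>\<^sup>+\<omega>. ennreal \<gamma> \<partial>M)"
  \<comment> \<open>The bounds on the conditional probabilities \<open>g\<close> hold almost
    everywhere only.\<close>
  proof (rule nn_integral_mono_AE)
    show "AE \<omega> in M. (\<integral>\<^sup>+\<sigma>. (\<Sum>l\<in>?I \<rightarrow>\<^sub>E {-1, 1}. ennreal ((\<Prod>i\<in>?I. q \<omega> i (l i)) * of_bool (?ex l (Y \<omega>) \<sigma>))) \<partial>?S)
      \<le> ennreal \<gamma>"
      using g_range AE_space
    proof eventually_elim
      fix \<omega> assume g: "\<forall>i\<in>N. 0 \<le> g i \<omega> \<and> g i \<omega> \<le> c0" and \<omega>: "\<omega> \<in> space M"
      show "(\<integral>\<^sup>+\<sigma>. (\<Sum>l\<in>?I \<rightarrow>\<^sub>E {-1, 1}. ennreal ((\<Prod>i\<in>?I. q \<omega> i (l i)) * of_bool (?ex l (Y \<omega>) \<sigma>))) \<partial>?S)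
        \<le> ennreal \<gamma>"
      proof (rule RM.nn_integral_seed_excess_le[where ?l0.0 = "\<lambda>i. L i \<omega>"])
        show "Y \<omega> \<in> space ?SY" by (rule measurable_space[OF Y \<omega>])
        show "0 \<le> q \<omega> i y" for i y using g c0 by (fastforce simp: q_def)
        show "q \<omega> i (-1) + q \<omega> i 1 = 1" if "i \<in> ?I" for i
          using L_val[OF that \<omega>] by (auto simp: q_def)
        show "q \<omega> i 1 \<le> c0" if "i \<in> N" for i using g that by (simp add: q_def)
        show "q \<omega> i y = 0" if "i \<in> ?I - N" "y \<noteq> L i \<omega>" for i y using that by (simp add: q_def)
      qed
    qed
  qed
  also have "\<dots> = ennreal \<gamma>" by (simp add: M.emeasure_space_1)
  finally show ?thesis
    unfolding event using gamma by (simp add: M.emeasure_eq_measure)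
qed

end
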